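(* Let $\Theta\subset\mathbb{R}^p$ be compact and convex, $\theta_0$ an interior point of $\Theta$, and let $\Theta\to M(T)$, $\theta\mapsto\mu_\theta$, be continuous and belong to $C^2(\Theta;M(T))$. Suppose that for $\theta\in\Theta$, $\mathcal{K}\mu_\theta(t)=\mathcal{K}\mu_{\theta_0}(t)$ for all $t\in T$ implies $\theta=\theta_0$, and that the $p\times p$ matrix $\Sigma$ with entries $\Sigma_{ij}=\langle\partial_i\mu_{\theta_0},\mathcal{K}\partial_j\mu_{\theta_0}\rangle$ is regular (invertible). Let $h_0=\mathcal{K}\mu_{\theta_0}$, $X^\varepsilon=h_0+\varepsilon Z$ for $\varepsilon>0$, and let $\hat\theta_\varepsilon\in\Theta$ be a maximizer over $\Theta$ of $\Phi_\varepsilon(\theta)=\langle\mu_\theta,X^\varepsilon\rangle-\tfrac12\langle\mu_\theta,\mathcal{K}\mu_\theta\rangle$. Then, as $\varepsilon\to0$, $$\varepsilon^{-1}(\hat\theta_\varepsilon-\theta_0)\to\Sigma^{-1}\langle\nabla_\theta\mu_{\theta_0},Z\rangle\quad\text{in probability},$$ and the limit has distribution $N(0,\Sigma^{-1})$.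
   Context: $T\subset\mathbb{R}$ is a closed bounded interval; $C(T)$ is the Banach space of continuous real functions on $T$ with the sup norm; $M(T)=C(T)^*$ is the space of finite signed Borel measures on $T$ with the total variation norm; $\langle\mu,x\rangle=\int_T x_t\,\mu(dt)$. $Z$ is a centered Gaussian vector on $C(T)$, i.e. a $C(T)$-valued random vector on a probability space $(\Omega,\mathbb{P})$ such that $\langle\mu,Z\rangle$ is a centered normal variable for every $\mu\in M(T)$. Its covariance function $K(s,t)=\mathrm{Cov}[Z_s,Z_t]$ is continuous on $T^2$ and its covariance operator $\mathcal{K}:M(T)\to C(T)$ is $(\mathcal{K}\mu)(s)=\int_T K(s,t)\,\mu(dt)$. $C^k(\Theta;M(T))$ is the set of maps $\theta\mapsto\mu_\theta$ from $\Theta$ to $M(T)$ that are $k$ times Fréchet differentiable (total variation norm on $M(T)$) with uniformly continuous partial derivatives of order $k$; that is, differentiable in the interior of $\Theta$, with partial derivatives of order at most $k$ extending continuously to $\Theta$. $\partial_i=\partial/\partial\theta_i$, $\nabla_\theta=(\partial_1,\dots,\partial_p)^{\mathsf T}$, and $\langle\nabla_\theta\mu_{\theta_0},Z\rangle=(\langle\partial_1\mu_{\theta_0},Z\rangle,\dots,\langle\partial_p\mu_{\theta_0},Z\rangle)^{\mathsf T}$. *)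

theory Defs
  imports "HOL-Probability.Probability"
begin

section \<open>Finite signed Borel measures with the total variation norm\<close>

definition countably_additive_real :: "(real set \<Rightarrow> real) \<Rightarrow> bool" where
  "countably_additive_real m \<longleftrightarrow>
     (\<forall>F. range F \<subseteq> sets borel \<longrightarrow> disjoint_family F \<longrightarrow>
        (\<lambda>n::nat. m (F n)) sums m (\<Union>n. F n))"

text \<open>Set functions are extended by 0 to non-Borel sets, so that equality of signed measures is
  equality of functions.\<close>

typedef signed_measure =
  "{m :: real set \<Rightarrow> real. countably_additive_real m \<and> (\<forall>A. A \<notin> sets borel \<longrightarrow> m A = 0)}"
  morphisms smeasure Abs_signed_measure
  by (rule exI[of _ "\<lambda>_. 0"]) (auto simp: countably_additive_real_def)

setup_lifting type_definition_signed_measure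

lemma smeasure_sums:
  "range F \<subseteq> sets borel \<Longrightarrow> disjoint_family F \<Longrightarrow>
     (\<lambda>n::nat. smeasure \<mu> (F n)) sums smeasure \<mu> (\<Union>n. F n)"
  using smeasure[of \<mu>] by (auto simp: countably_additive_real_def)

lemma smeasure_empty [simp]: "smeasure \<mu> {} = 0"
proof -
  have "(\<lambda>n::nat. smeasure \<mu> {}) sums smeasure \<mu> {}"
    using smeasure_sums[of "\<lambda>_. {}" \<mu>] by (simp add: disjoint_family_on_def)
  then show ?thesis
    using sums_summable summable_const_iff by blast
qed

lemma smeasure_not_sets: "A \<notin> sets borel \<Longrightarrow> smeasure \<mu> A = 0"
  using smeasure[of \<mu>] by auto

lemma smeasure_Un:
  assumes "A \<in> sets borel" "B \<in> sets borel" "A \<inter> B = {}"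
  shows "smeasure \<mu> (A \<union> B) = smeasure \<mu> A + smeasure \<mu> B"
proof -
  have "(\<lambda>n. smeasure \<mu> (binaryset A B n)) sums smeasure \<mu> (\<Union>n. binaryset A B n)"
    using assms by (intro smeasure_sums)
      (auto simp: binaryset_def disjoint_family_on_def split: if_splits)
  moreover have "(\<lambda>n. smeasure \<mu> (binaryset A B n)) sums (smeasure \<mu> A + smeasure \<mu> B)"
    by (rule binaryset_sums) simp
  ultimately show ?thesis
    using sums_unique2 UN_binaryset_eq by metis
qed

lemma smeasure_Diff:
  assumes "A \<in> sets borel" "B \<in> sets borel" "B \<subseteq> A"
  shows "smeasure \<mu> (A - B) = smeasure \<mu> A - smeasure \<mu> B"
proof -
  have "smeasure \<mu> (B \<union> (A - B)) = smeasure \<mu> B + smeasure \<mu> (A - B)"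
    using assms by (intro smeasure_Un) auto
  moreover have "B \<union> (A - B) = A"
    using assms by auto
  ultimately show ?thesis by simp
qed

lemma smeasure_Union:
  assumes "finite P" "disjoint P" "P \<subseteq> sets borel"
  shows "smeasure \<mu> (\<Union>P) = (\<Sum>A\<in>P. smeasure \<mu> A)"
  using assms
proof (induction P rule: finite_induct)
  case (insert A P)
  have "disjoint P"
    using insert.prems(1) by (rule pairwise_subset) auto
  moreover have "A \<inter> \<Union>P = {}"
    using insert.prems(1) insert.hyps(2) by (auto simp: pairwise_insert disjnt_def)
  ultimately show ?case
    using insert
    by (subst Union_insert, subst smeasure_Un) (auto intro!: sets.finite_Union)
qed simp

text \<open>A countably additive real-valued set function is automatically bounded, so the total
  variation below is a supremum of a bounded set.\<close>

lemma smeasure_bounded: "\<exists>R. \<forall>A. \<bar>smeasure \<mu> A\<bar> \<le> R"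
proof (rule ccontr)
  define unb where "unb E \<longleftrightarrow> (\<forall>R. \<exists>B\<in>sets borel. B \<subseteq> E \<and> \<bar>smeasure \<mu> B\<bar> > R)" for E
  assume neg: "\<not> ?thesis"
  have unb_UNIV: "unb UNIV"
    unfolding unb_def
  proof
    fix R :: real
    obtain A where A: "\<bar>smeasure \<mu> A\<bar> > max R 0"
      using neg by (meson not_le)
    then have "A \<in> sets borel"
      using smeasure_not_sets[of A \<mu>] by (cases "A \<in> sets borel") auto
    with A show "\<exists>B\<in>sets borel. B \<subseteq> UNIV \<and> R < \<bar>smeasure \<mu> B\<bar>" by auto
  qed
  have step: "\<exists>A. (A \<in> sets borel \<and> unb A) \<and> A \<subseteq> E \<and> \<bar>smeasure \<mu> (E - A)\<bar> > 1"
    if E: "E \<in> sets borel" "unb E" for E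
  proof -
    obtain B where B: "B \<in> sets borel" "B \<subseteq> E" "\<bar>smeasure \<mu> B\<bar> > \<bar>smeasure \<mu> E\<bar> + 1"
      using E(2) unfolding unb_def by blast
    have D: "\<bar>smeasure \<mu> (E - B)\<bar> > 1"
      using smeasure_Diff[OF E(1) B(1,2), of \<mu>] B(3) by linarith
    show ?thesis
    proof (cases "unb B")
      case True
      with B D show ?thesis by blast
    next
      case False
      then obtain R where R: "\<And>C. C \<in> sets borel \<Longrightarrow> C \<subseteq> B \<Longrightarrow> \<bar>smeasure \<mu> C\<bar> \<le> R"
        unfolding unb_def by (meson not_le)
      have "unb (E - B)"
        unfolding unb_def
      proof
        fix S
        obtain C where C: "C \<in> sets borel" "C \<subseteq> E" "\<bar>smeasure \<mu> C\<bar> > S + R"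
          using E(2) unfolding unb_def by blast
        have "smeasure \<mu> (C - C \<inter> B) = smeasure \<mu> C - smeasure \<mu> (C \<inter> B)"
          using B C by (intro smeasure_Diff) auto
        moreover have "\<bar>smeasure \<mu> (C \<inter> B)\<bar> \<le> R"
          using B C by (intro R) auto
        ultimately have "\<bar>smeasure \<mu> (C - C \<inter> B)\<bar> > S"
          using C(3) by linarith
        then show "\<exists>D\<in>sets borel. D \<subseteq> E - B \<and> S < \<bar>smeasure \<mu> D\<bar>"
          using B C by (intro bexI[of _ "C - C \<inter> B"]) auto
      qed
      moreover have "E - (E - B) = B" using B by auto
      ultimately show ?thesis
        using B E by (intro exI[of _ "E - B"]) auto
    qed
  qed
  obtain E :: "nat \<Rightarrow> real set" where
    "\<forall>n. (E n \<in> sets borel \<and> unb (E n)) \<and>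
      E (Suc n) \<subseteq> E n \<and> \<bar>smeasure \<mu> (E n - E (Suc n))\<bar> > 1"
  proof (atomize_elim, rule dependent_nat_choice)
    show "\<exists>E. E \<in> sets borel \<and> unb E"
      using unb_UNIV by (intro exI[of _ UNIV]) simp
  qed (rule step, auto)
  then have E: "\<And>n. E n \<in> sets borel" "\<And>n. E (Suc n) \<subseteq> E n"
      "\<And>n. \<bar>smeasure \<mu> (E n - E (Suc n))\<bar> > 1"
    by auto
  have dec: "E n \<subseteq> E m" if "m \<le> n" for m n
    by (rule lift_Suc_antimono_le[of E, OF E(2) that])
  have lt: "(E m - E (Suc m)) \<inter> (E n - E (Suc n)) = {}" if "m < n" for m n
    using that dec[of "Suc m" n] by auto
  have "disjoint_family (\<lambda>n. E n - E (Suc n))"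
    unfolding disjoint_family_on_def
  proof (intro ballI impI)
    fix m n :: nat assume "m \<noteq> n"
    then show "(E m - E (Suc m)) \<inter> (E n - E (Suc n)) = {}"
      using lt[of m n] lt[of n m] by (cases "m < n") (auto simp: Int_commute)
  qed
  then have "(\<lambda>n. smeasure \<mu> (E n - E (Suc n))) sums smeasure \<mu> (\<Union>n. E n - E (Suc n))"
    using E(1) by (intro smeasure_sums) auto
  then have "(\<lambda>n. smeasure \<mu> (E n - E (Suc n))) \<longlonglongrightarrow> 0"
    by (simp add: sums_summable summable_LIMSEQ_zero)
  then have "eventually (\<lambda>n. \<bar>smeasure \<mu> (E n - E (Suc n))\<bar> < 1) sequentially"
    using order_tendstoD(2)[OF tendsto_rabs_zero, of _ sequentially 1] by simp
  then obtain n where "\<bar>smeasure \<mu> (E n - E (Suc n))\<bar> < 1"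
    by (auto simp: eventually_sequentially)
  with E(3)[of n] show False by linarith
qed

definition borel_families :: "real set set set" where
  "borel_families = {P. finite P \<and> disjoint P \<and> P \<subseteq> sets borel}"

definition total_variation :: "signed_measure \<Rightarrow> real" where
  "total_variation \<mu> = (SUP P\<in>borel_families. \<Sum>A\<in>P. \<bar>smeasure \<mu> A\<bar>)"

lemma bdd_above_variation: "bdd_above ((\<lambda>P. \<Sum>A\<in>P. \<bar>smeasure \<mu> A\<bar>) ` borel_families)"
proof -
  obtain R where R: "\<And>A. \<bar>smeasure \<mu> A\<bar> \<le> R"
    using smeasure_bounded by blast
  have "(\<Sum>A\<in>P. \<bar>smeasure \<mu> A\<bar>) \<le> 2 * R" if P: "P \<in> borel_families" for P
  proof -
    let ?Q = "{A\<in>P. smeasure \<mu> A \<ge> 0}" and ?N = "{A\<in>P. smeasure \<mu> A < 0}"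
    have fin: "finite P" and PQN: "P = ?Q \<union> ?N" "?Q \<inter> ?N = {}"
      using P by (auto simp: borel_families_def)
    have "(\<Sum>A\<in>P. \<bar>smeasure \<mu> A\<bar>) = (\<Sum>A\<in>?Q. \<bar>smeasure \<mu> A\<bar>) + (\<Sum>A\<in>?N. \<bar>smeasure \<mu> A\<bar>)"
      using fin PQN by (subst PQN(1), subst sum.union_disjoint) auto
    also have "\<dots> = (\<Sum>A\<in>?Q. smeasure \<mu> A) - (\<Sum>A\<in>?N. smeasure \<mu> A)"
      by (simp add: sum_negf[symmetric] diff_conv_add_uminus del: sum_negf add_uminus_conv_diff)
    also have "\<dots> = smeasure \<mu> (\<Union>?Q) - smeasure \<mu> (\<Union>?N)"
      using P by (subst (1 2) smeasure_Union) (auto simp: borel_families_def disjoint_def)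
    finally show ?thesis
      using R[of "\<Union>?Q"] R[of "\<Union>?N"] by linarith
  qed
  then show ?thesis by (auto intro!: bdd_aboveI)
qed

lemma variation_le_total_variation:
  "P \<in> borel_families \<Longrightarrow> (\<Sum>A\<in>P. \<bar>smeasure \<mu> A\<bar>) \<le> total_variation \<mu>"
  unfolding total_variation_def by (intro cSUP_upper bdd_above_variation)

lemma total_variation_le:
  "(\<And>P. P \<in> borel_families \<Longrightarrow> (\<Sum>A\<in>P. \<bar>smeasure \<mu> A\<bar>) \<le> c) \<Longrightarrow> total_variation \<mu> \<le> c"
  unfolding total_variation_def
  by (intro cSUP_least) (auto simp: borel_families_def intro!: exI[of _ "{}"])

lemma abs_smeasure_le: "\<bar>smeasure \<mu> A\<bar> \<le> total_variation \<mu>"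
proof (cases "A \<in> sets borel")
  case True
  then show ?thesis
    using variation_le_total_variation[of "{A}" \<mu>] by (auto simp: borel_families_def)
next
  case False
  then show ?thesis
    using variation_le_total_variation[of "{}" \<mu>]
    by (auto simp: borel_families_def smeasure_not_sets)
qed

instantiation signed_measure :: real_normed_vector
begin

lift_definition zero_signed_measure :: signed_measure is "\<lambda>_. 0"
  by (auto simp: countably_additive_real_def)

lift_definition plus_signed_measure :: "signed_measure \<Rightarrow> signed_measure \<Rightarrow> signed_measure"
  is "\<lambda>m n A. m A + n A"
  by (auto simp: countably_additive_real_def intro!: sums_add)

lift_definition minus_signed_measure :: "signed_measure \<Rightarrow> signed_measure \<Rightarrow> signed_measure"
  is "\<lambda>m n A. m A - n A"
  by (auto simp: countably_additive_real_def intro!: sums_diff)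

lift_definition uminus_signed_measure :: "signed_measure \<Rightarrow> signed_measure"
  is "\<lambda>m A. - m A"
  by (auto simp: countably_additive_real_def intro!: sums_minus)

lift_definition scaleR_signed_measure :: "real \<Rightarrow> signed_measure \<Rightarrow> signed_measure"
  is "\<lambda>c m A. c * m A"
  by (auto simp: countably_additive_real_def intro!: sums_mult)

definition norm_signed_measure :: "signed_measure \<Rightarrow> real" where
  "norm_signed_measure = total_variation"

definition dist_signed_measure :: "signed_measure \<Rightarrow> signed_measure \<Rightarrow> real" where
  "dist_signed_measure \<mu> \<nu> = norm (\<mu> - \<nu>)"

definition sgn_signed_measure :: "signed_measure \<Rightarrow> signed_measure" where
  "sgn_signed_measure \<mu> = inverse (norm \<mu>) *\<^sub>R \<mu>"

definition uniformity_signed_measure :: "(signed_measure \<times> signed_measure) filter" where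
  "uniformity_signed_measure = (INF e\<in>{0<..}. principal {(\<mu>, \<nu>). dist \<mu> \<nu> < e})"

definition open_signed_measure :: "signed_measure set \<Rightarrow> bool" where
  "open_signed_measure U \<longleftrightarrow>
     (\<forall>\<mu>\<in>U. eventually (\<lambda>(\<mu>', \<nu>). \<mu>' = \<mu> \<longrightarrow> \<nu> \<in> U) uniformity)"

instance
proof
  fix \<mu> \<nu> \<rho> :: signed_measure and a b :: real
  show "\<mu> + \<nu> + \<rho> = \<mu> + (\<nu> + \<rho>)" by transfer (simp add: add.assoc)
  show "\<mu> + \<nu> = \<nu> + \<mu>" by transfer (simp add: add.commute)
  show "0 + \<mu> = \<mu>" by transfer simp
  show "- \<mu> + \<mu> = 0" by transfer simp
  show "\<mu> - \<nu> = \<mu> + - \<nu>" by transfer simp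
  show "a *\<^sub>R (\<mu> + \<nu>) = a *\<^sub>R \<mu> + a *\<^sub>R \<nu>" by transfer (simp add: distrib_left)
  show "(a + b) *\<^sub>R \<mu> = a *\<^sub>R \<mu> + b *\<^sub>R \<mu>" by transfer (simp add: distrib_right)
  show "a *\<^sub>R b *\<^sub>R \<mu> = (a * b) *\<^sub>R \<mu>" by transfer (simp add: mult.assoc)
  show "1 *\<^sub>R \<mu> = \<mu>" by transfer simp
  show "dist \<mu> \<nu> = norm (\<mu> - \<nu>)" by (rule dist_signed_measure_def)
  show "sgn \<mu> = inverse (norm \<mu>) *\<^sub>R \<mu>" by (rule sgn_signed_measure_def)
  show "(uniformity :: (signed_measure \<times> signed_measure) filter) =
      (INF e\<in>{0<..}. principal {(\<mu>, \<nu>). dist \<mu> \<nu> < e})"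
    by (rule uniformity_signed_measure_def)
  show "open U \<longleftrightarrow> (\<forall>\<mu>\<in>U. \<forall>\<^sub>F (\<mu>', \<nu>) in uniformity. \<mu>' = \<mu> \<longrightarrow> \<nu> \<in> U)"
    for U :: "signed_measure set"
    by (rule open_signed_measure_def)
  show "norm \<mu> = 0 \<longleftrightarrow> \<mu> = 0"
  proof
    assume "norm \<mu> = 0"
    then have "smeasure \<mu> A = 0" for A
      using abs_smeasure_le[of \<mu> A] by (simp add: norm_signed_measure_def)
    then show "\<mu> = 0" by transfer auto
  next
    assume "\<mu> = 0"
    then have "total_variation \<mu> \<le> 0"
      by (intro total_variation_le) (simp add: zero_signed_measure.rep_eq)
    then show "norm \<mu> = 0"
      using abs_smeasure_le[of \<mu> "{}"] by (simp add: norm_signed_measure_def)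
  qed
  show "norm (\<mu> + \<nu>) \<le> norm \<mu> + norm \<nu>"
    unfolding norm_signed_measure_def
  proof (rule total_variation_le)
    fix P assume P: "P \<in> borel_families"
    have "(\<Sum>A\<in>P. \<bar>smeasure (\<mu> + \<nu>) A\<bar>) \<le> (\<Sum>A\<in>P. \<bar>smeasure \<mu> A\<bar>) + (\<Sum>A\<in>P. \<bar>smeasure \<nu> A\<bar>)"
      by (simp add: plus_signed_measure.rep_eq sum.distrib[symmetric] sum_mono)
    then show "(\<Sum>A\<in>P. \<bar>smeasure (\<mu> + \<nu>) A\<bar>) \<le> total_variation \<mu> + total_variation \<nu>"
      using variation_le_total_variation[OF P, of \<mu>] variation_le_total_variation[OF P, of \<nu>]
      by linarith
  qed
  have le: "norm (a *\<^sub>R \<mu>) \<le> \<bar>a\<bar> * norm \<mu>" for a and \<mu> :: signed_measure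
    unfolding norm_signed_measure_def
    by (intro total_variation_le)
      (auto simp: scaleR_signed_measure.rep_eq abs_mult sum_distrib_left[symmetric]
        intro!: mult_left_mono variation_le_total_variation)
  show "norm (a *\<^sub>R \<mu>) = \<bar>a\<bar> * norm \<mu>"
  proof (cases "a = 0")
    case True
    have "0 \<le> norm (a *\<^sub>R \<mu>)"
      using abs_smeasure_le[of "a *\<^sub>R \<mu>" "{}"] by (simp add: norm_signed_measure_def)
    with le[of a \<mu>] True show ?thesis by simp
  next
    case False
    have "inverse a *\<^sub>R a *\<^sub>R \<mu> = \<mu>"
      using False by transfer auto
    then have "norm \<mu> \<le> \<bar>inverse a\<bar> * norm (a *\<^sub>R \<mu>)"
      using le[of "inverse a" "a *\<^sub>R \<mu>"] by simp
    then have "\<bar>a\<bar> * norm \<mu> \<le> norm (a *\<^sub>R \<mu>)"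
      using False by (simp add: field_simps abs_inverse)
    with le[of a \<mu>] show ?thesis by simp
  qed
qed

end

text \<open>The space \<open>M(T)\<close>: the signed measures on the line that vanish off \<open>T\<close>. For Borel \<open>T\<close> this is
  a closed subspace, isometric to the space of signed measures on the Borel sets of \<open>T\<close>.\<close>

definition signed_measures_on :: "real set \<Rightarrow> signed_measure set" where
  "signed_measures_on T = {\<mu>. \<forall>A\<in>sets borel. A \<inter> T = {} \<longrightarrow> smeasure \<mu> A = 0}"

text \<open>Jordan decomposition \<open>\<mu> = \<mu>\<^sup>+ - \<mu>\<^sup>-\<close>, where \<open>\<mu>\<^sup>+ A\<close> is the supremum of \<open>\<mu> B\<close> over Borel \<open>B \<subseteq> A\<close>.\<close>

definition upper_variation :: "signed_measure \<Rightarrow> real set \<Rightarrow> real" where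
  "upper_variation \<mu> A = (SUP B\<in>{B\<in>sets borel. B \<subseteq> A}. smeasure \<mu> B)"

definition pos_part :: "signed_measure \<Rightarrow> real measure" where
  "pos_part \<mu> = measure_of UNIV (sets borel) (\<lambda>A. ennreal (upper_variation \<mu> A))"

definition neg_part :: "signed_measure \<Rightarrow> real measure" where
  "neg_part \<mu> = pos_part (- \<mu>)"

lemma bdd_above_smeasure: "bdd_above (smeasure \<mu> ` \<B>)"
  using abs_smeasure_le[of \<mu>]
  by (auto intro!: bdd_aboveI[where M = "total_variation \<mu>"] dest: abs_le_D1)

lemma smeasure_le_upper_variation:
  "B \<in> sets borel \<Longrightarrow> B \<subseteq> A \<Longrightarrow> smeasure \<mu> B \<le> upper_variation \<mu> A"
  unfolding upper_variation_def by (intro cSUP_upper bdd_above_smeasure) auto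

lemma upper_variation_le:
  "(\<And>B. B \<in> sets borel \<Longrightarrow> B \<subseteq> A \<Longrightarrow> smeasure \<mu> B \<le> c) \<Longrightarrow> upper_variation \<mu> A \<le> c"
  unfolding upper_variation_def by (intro cSUP_least) auto

lemma upper_variation_nonneg: "0 \<le> upper_variation \<mu> A"
  using smeasure_le_upper_variation[of "{}" A \<mu>] by simp

lemma upper_variation_mono: "A \<subseteq> B \<Longrightarrow> upper_variation \<mu> A \<le> upper_variation \<mu> B"
  by (intro upper_variation_le smeasure_le_upper_variation) auto

lemma upper_variation_superadd:
  assumes "A \<inter> B = {}"
  shows "upper_variation \<mu> A + upper_variation \<mu> B \<le> upper_variation \<mu> (A \<union> B)"
proof -
  have "smeasure \<mu> C + smeasure \<mu> D \<le> upper_variation \<mu> (A \<union> B)"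
    if "C \<in> sets borel" "C \<subseteq> A" "D \<in> sets borel" "D \<subseteq> B" for C D
  proof -
    have "C \<inter> D = {}" using that assms by auto
    then have "smeasure \<mu> C + smeasure \<mu> D = smeasure \<mu> (C \<union> D)"
      using that by (intro smeasure_Un[symmetric])
    also have "\<dots> \<le> upper_variation \<mu> (A \<union> B)"
      using that by (intro smeasure_le_upper_variation) auto
    finally show ?thesis .
  qed
  then have "upper_variation \<mu> A \<le> upper_variation \<mu> (A \<union> B) - smeasure \<mu> D"
    if "D \<in> sets borel" "D \<subseteq> B" for D
    using that by (intro upper_variation_le) (simp add: le_diff_eq)
  then have "upper_variation \<mu> B \<le> upper_variation \<mu> (A \<union> B) - upper_variation \<mu> A"
    by (intro upper_variation_le) (simp add: le_diff_eq add.commute)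
  then show ?thesis by simp
qed

lemma upper_variation_sums:
  assumes F: "range F \<subseteq> sets borel" "disjoint_family F"
  shows "(\<lambda>n::nat. upper_variation \<mu> (F n)) sums upper_variation \<mu> (\<Union>n. F n)"
proof -
  have part: "(\<Sum>k<n. upper_variation \<mu> (F k)) \<le> upper_variation \<mu> (\<Union>k<n. F k)" for n
  proof (induction n)
    case (Suc n)
    have "F k \<inter> F n = {}" if "k < n" for k
      using F(2) that by (simp add: disjoint_family_on_def)
    then have "(\<Union>k<n. F k) \<inter> F n = {}" by blast
    from upper_variation_superadd[OF this, of \<mu>] Suc show ?case
      by (simp add: lessThan_Suc Un_commute add.commute)
  qed (simp add: upper_variation_nonneg)
  have part': "(\<Sum>k<n. upper_variation \<mu> (F k)) \<le> upper_variation \<mu> (\<Union>n. F n)" for n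
    by (rule order_trans[OF part upper_variation_mono]) auto
  have summ: "summable (\<lambda>n. upper_variation \<mu> (F n))"
    by (rule summableI_nonneg_bounded[OF upper_variation_nonneg part'])
  moreover have "upper_variation \<mu> (\<Union>n. F n) \<le> (\<Sum>n. upper_variation \<mu> (F n))"
  proof (rule upper_variation_le)
    fix B assume B: "B \<in> sets borel" "B \<subseteq> (\<Union>n. F n)"
    have eq: "(\<Union>n. B \<inter> F n) = B" using B by auto
    have "(\<lambda>n. smeasure \<mu> (B \<inter> F n)) sums smeasure \<mu> (\<Union>n. B \<inter> F n)"
      using F B by (intro smeasure_sums) (auto simp: disjoint_family_on_def)
    then have "(\<lambda>n. smeasure \<mu> (B \<inter> F n)) sums smeasure \<mu> B" by (simp only: eq)
    then show "smeasure \<mu> B \<le> (\<Sum>n. upper_variation \<mu> (F n))"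
      using F B by (intro sums_le[OF _ _ summable_sums[OF summ]])
        (auto intro!: smeasure_le_upper_variation)
  qed
  moreover have "(\<Sum>n. upper_variation \<mu> (F n)) \<le> upper_variation \<mu> (\<Union>n. F n)"
    by (rule suminf_le_const[OF summ part'])
  ultimately show ?thesis
    by (metis antisym summable_sums)
qed

lemma sets_pos_part [simp, measurable_cong]: "sets (pos_part \<mu>) = sets borel"
  using sets.sigma_sets_eq[of "borel :: real measure"] by (simp add: pos_part_def)

lemma space_pos_part [simp]: "space (pos_part \<mu>) = UNIV"
  by (simp add: pos_part_def)

lemma emeasure_pos_part:
  assumes "A \<in> sets borel"
  shows "emeasure (pos_part \<mu>) A = ennreal (upper_variation \<mu> A)"
proof (rule emeasure_measure_of[OF pos_part_def])
  show "sets borel \<subseteq> Pow UNIV" "A \<in> sets (pos_part \<mu>)" using assms by auto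
  have "upper_variation \<mu> {} \<le> 0" by (rule upper_variation_le) auto
  then show "positive (sets (pos_part \<mu>)) (\<lambda>A. ennreal (upper_variation \<mu> A))"
    by (simp add: positive_def ennreal_neg)
  show "countably_additive (sets (pos_part \<mu>)) (\<lambda>A. ennreal (upper_variation \<mu> A))"
    unfolding countably_additive_def
  proof (intro allI impI)
    fix F :: "nat \<Rightarrow> real set"
    assume F: "range F \<subseteq> sets (pos_part \<mu>)" "disjoint_family F"
    then have "(\<lambda>n. upper_variation \<mu> (F n)) sums upper_variation \<mu> (\<Union>n. F n)"
      by (intro upper_variation_sums) auto
    then show "(\<Sum>n. ennreal (upper_variation \<mu> (F n))) = ennreal (upper_variation \<mu> (\<Union>n. F n))"
      by (intro suminf_ennreal_eq) (auto intro: upper_variation_nonneg)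
  qed
qed

lemma upper_variation_diff:
  assumes "A \<in> sets borel"
  shows "smeasure \<mu> A = upper_variation \<mu> A - upper_variation (- \<mu>) A"
proof -
  have "smeasure \<mu> B \<le> smeasure \<mu> A + upper_variation (- \<mu>) A" if "B \<in> sets borel" "B \<subseteq> A" for B \<mu>
    using that assms smeasure_le_upper_variation[of "A - B" A "- \<mu>"] smeasure_Diff[of A B \<mu>]
    by (simp add: uminus_signed_measure.rep_eq)
  then have le: "upper_variation \<mu> A \<le> smeasure \<mu> A + upper_variation (- \<mu>) A" for \<mu>
    by (rule upper_variation_le)
  from le[of \<mu>] le[of "- \<mu>"] show ?thesis
    by (simp add: uminus_signed_measure.rep_eq)
qed

lemma smeasure_eq_pos_part_minus_neg_part:
  "A \<in> sets borel \<Longrightarrow> smeasure \<mu> A = measure (pos_part \<mu>) A - measure (neg_part \<mu>) A"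
  by (simp add: neg_part_def measure_def emeasure_pos_part upper_variation_nonneg
      upper_variation_diff[symmetric])

text \<open>The duality \<open>\<langle>\<mu>, x\<rangle>\<close>.\<close>

definition pairing :: "real set \<Rightarrow> signed_measure \<Rightarrow> (real \<Rightarrow> real) \<Rightarrow> real" where
  "pairing T \<mu> x = (LINT t:T|pos_part \<mu>. x t) - (LINT t:T|neg_part \<mu>. x t)"


section \<open>Gaussian vectors\<close>

text \<open>One-dimensional normal laws include the degenerate ones (variance 0).\<close>

definition normal_law :: "real \<Rightarrow> real \<Rightarrow> real measure" where
  "normal_law m v =
     (if v = 0 then return borel m else density lborel (normal_density m (sqrt v)))"

definition normal_rv :: "'w measure \<Rightarrow> ('w \<Rightarrow> real) \<Rightarrow> real \<Rightarrow> real \<Rightarrow> bool" where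
  "normal_rv M X m v \<longleftrightarrow> 0 \<le> v \<and> X \<in> borel_measurable M \<and> distr M borel X = normal_law m v"

text \<open>\<open>X\<close> has law \<open>N(m, C)\<close>: every linear functional \<open>u \<bullet> X\<close> is normal with mean \<open>u \<bullet> m\<close> and
  variance \<open>u \<bullet> C u\<close>. Symmetry of \<open>C\<close> is required because the variances determine only the
  symmetric part of \<open>C\<close>.\<close>

definition normal_vector :: "'w measure \<Rightarrow> ('w \<Rightarrow> real ^ 'p) \<Rightarrow> real ^ 'p \<Rightarrow> real ^ 'p ^ 'p \<Rightarrow> bool" where
  "normal_vector M X m C \<longleftrightarrow> X \<in> borel_measurable M \<and> transpose C = C \<and>
     (\<forall>u. normal_rv M (\<lambda>\<omega>. u \<bullet> X \<omega>) (u \<bullet> m) (u \<bullet> (C *v u)))"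

text \<open>\<open>C(T)\<close> for compact \<open>T\<close>, with the sup metric; its elements are functions with value
  \<open>undefined\<close> off \<open>T\<close>, so only their values on \<open>T\<close> may be used.\<close>

definition C_space :: "real set \<Rightarrow> (real \<Rightarrow> real) metric" where
  "C_space T = cfunspace (top_of_set T) euclidean_metric"

definition C_borel :: "real set \<Rightarrow> (real \<Rightarrow> real) measure" where
  "C_borel T = sigma (mspace (C_space T)) {U. openin (mtopology_of (C_space T)) U}"

definition centered_gaussian_vector ::
  "'w measure \<Rightarrow> real set \<Rightarrow> ('w \<Rightarrow> real \<Rightarrow> real) \<Rightarrow> bool" where
  "centered_gaussian_vector M T Z \<longleftrightarrow> Z \<in> measurable M (C_borel T) \<and>
     (\<forall>\<mu>\<in>signed_measures_on T. \<exists>v. normal_rv M (\<lambda>\<omega>. pairing T \<mu> (Z \<omega>)) 0 v)"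

definition covariance :: "'w measure \<Rightarrow> ('w \<Rightarrow> real) \<Rightarrow> ('w \<Rightarrow> real) \<Rightarrow> real" where
  "covariance M X Y = (LINT \<omega>|M. (X \<omega> - (LINT \<omega>'|M. X \<omega>')) * (Y \<omega> - (LINT \<omega>'|M. Y \<omega>')))"

definition cov_fun :: "'w measure \<Rightarrow> ('w \<Rightarrow> real \<Rightarrow> real) \<Rightarrow> real \<Rightarrow> real \<Rightarrow> real" where
  "cov_fun M Z s t = covariance M (\<lambda>\<omega>. Z \<omega> s) (\<lambda>\<omega>. Z \<omega> t)"

definition cov_op ::
  "'w measure \<Rightarrow> real set \<Rightarrow> ('w \<Rightarrow> real \<Rightarrow> real) \<Rightarrow> signed_measure \<Rightarrow> real \<Rightarrow> real" where
  "cov_op M T Z \<mu> s = pairing T \<mu> (\<lambda>t. cov_fun M Z s t)"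


section \<open>Smooth maps on \<open>\<Theta>\<close>\<close>

definition partial_deriv ::
  "'p::finite \<Rightarrow> (real ^ 'p \<Rightarrow> 'b::real_normed_vector) \<Rightarrow> real ^ 'p \<Rightarrow> 'b" where
  "partial_deriv i f \<theta> = vector_derivative (\<lambda>t. f (\<theta> + t *\<^sub>R axis i 1)) (at 0)"

definition extends_continuously :: "(real ^ 'p) set \<Rightarrow> (real ^ 'p \<Rightarrow> 'b::real_normed_vector) \<Rightarrow> bool" where
  "extends_continuously \<Theta> f \<longleftrightarrow> (\<exists>g. continuous_on \<Theta> g \<and> (\<forall>\<theta>\<in>interior \<Theta>. g \<theta> = f \<theta>))"

text \<open>The class \<open>C\<^sup>k\<close>: Frechet differentiable \<open>k\<close> times in the interior of \<open>\<Theta>\<close>, with all partial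
  derivatives of order at most \<open>k\<close> extending continuously to \<open>\<Theta>\<close>. As the domain is
  finite-dimensional, the derivative is differentiable iff all partial derivatives are. For
  compact \<open>\<Theta>\<close> that is the closure of its interior and complete range, such an extension exists
  iff the function is uniformly continuous on the interior.\<close>

primrec C_k_on :: "nat \<Rightarrow> (real ^ 'p) set \<Rightarrow> (real ^ 'p \<Rightarrow> 'b::real_normed_vector) \<Rightarrow> bool" where
  "C_k_on 0 \<Theta> f \<longleftrightarrow> extends_continuously \<Theta> f"
| "C_k_on (Suc k) \<Theta> f \<longleftrightarrow> extends_continuously \<Theta> f \<and>
     (\<forall>\<theta>\<in>interior \<Theta>. f differentiable (at \<theta>)) \<and> (\<forall>i. C_k_on k \<Theta> (partial_deriv i f))"


section \<open>The estimation problem\<close>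

definition info_matrix ::
  "'w measure \<Rightarrow> real set \<Rightarrow> ('w \<Rightarrow> real \<Rightarrow> real) \<Rightarrow> (real ^ 'p \<Rightarrow> signed_measure) \<Rightarrow> real ^ 'p
     \<Rightarrow> real ^ 'p ^ 'p" where
  "info_matrix M T Z \<mu> \<theta>\<^sub>0 =
     (\<chi> i j. pairing T (partial_deriv i \<mu> \<theta>\<^sub>0) (cov_op M T Z (partial_deriv j \<mu> \<theta>\<^sub>0)))"

definition grad_pairing ::
  "real set \<Rightarrow> (real ^ 'p \<Rightarrow> signed_measure) \<Rightarrow> real ^ 'p \<Rightarrow> (real \<Rightarrow> real) \<Rightarrow> real ^ 'p" where
  "grad_pairing T \<mu> \<theta>\<^sub>0 x = (\<chi> i. pairing T (partial_deriv i \<mu> \<theta>\<^sub>0) x)"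

definition observation ::
  "'w measure \<Rightarrow> real set \<Rightarrow> ('w \<Rightarrow> real \<Rightarrow> real) \<Rightarrow> signed_measure \<Rightarrow> real \<Rightarrow> 'w \<Rightarrow> real \<Rightarrow> real" where
  "observation M T Z \<mu>\<^sub>0 \<epsilon> \<omega> t = cov_op M T Z \<mu>\<^sub>0 t + \<epsilon> * Z \<omega> t"

definition contrast ::
  "'w measure \<Rightarrow> real set \<Rightarrow> ('w \<Rightarrow> real \<Rightarrow> real) \<Rightarrow> (real \<Rightarrow> real) \<Rightarrow> signed_measure \<Rightarrow> real" where
  "contrast M T Z x \<nu> = pairing T \<nu> x - 1/2 * pairing T \<nu> (cov_op M T Z \<nu>)"

text \<open>Convergence in probability. The outer measure of an event is its probability; with the outer
  measure the notion is also meaningful for a choice of maximizers \<open>\<theta>hat \<epsilon> \<omega>\<close> that is not measurable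
  in \<open>\<omega>\<close>.\<close>

definition tendsto_in_prob ::
  "'w measure \<Rightarrow> ('i \<Rightarrow> 'w \<Rightarrow> 'b::metric_space) \<Rightarrow> ('w \<Rightarrow> 'b) \<Rightarrow> 'i filter \<Rightarrow> bool" where
  "tendsto_in_prob M X Y F \<longleftrightarrow>
     (\<forall>\<delta>>0. ((\<lambda>i. outer_measure_of M {\<omega>\<in>space M. dist (X i \<omega>) (Y \<omega>) > \<delta>}) \<longlongrightarrow> 0) F)"

lemma (in prob_space) tendsto_in_prob_iff_measurable:
  fixes X :: "'i \<Rightarrow> 'a \<Rightarrow> 'b::{metric_space, second_countable_topology}"
  assumes [measurable]: "\<And>i. X i \<in> borel_measurable M" "Y \<in> borel_measurable M"
  shows "tendsto_in_prob M X Y F \<longleftrightarrow>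
    (\<forall>\<delta>>0. ((\<lambda>i. prob {\<omega>\<in>space M. dist (X i \<omega>) (Y \<omega>) > \<delta>}) \<longlongrightarrow> 0) F)"
proof -
  have "outer_measure_of M {\<omega>\<in>space M. dist (X i \<omega>) (Y \<omega>) > \<delta>} =
      ennreal (prob {\<omega>\<in>space M. dist (X i \<omega>) (Y \<omega>) > \<delta>})" for i \<delta>
    by (subst outer_measure_of_eq) (auto simp: emeasure_eq_measure)
  then show ?thesis
    by (simp add: tendsto_in_prob_def tendsto_ennreal_iff flip: ennreal_0)
qed

end

theory Submission
  imports Defs
begin

text \<open>
  Write \<open>B \<mu> \<nu> = E (\<langle>\<mu>, Z\<rangle> \<langle>\<nu>, Z\<rangle>)\<close>. By Fubini \<open>\<langle>\<mu>, K \<nu>\<rangle> = B \<mu> \<nu>\<close> for the covariance operator \<open>K\<close>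
  (\<open>pairing_cov_op\<close>), so completing the square turns the contrast at \<open>\<mu> \<theta>\<close> into
  \<open>\<epsilon> \<langle>\<mu> \<theta> - \<mu> \<theta>\<^sub>0, Z\<rangle> - B (\<mu> \<theta> - \<mu> \<theta>\<^sub>0) (\<mu> \<theta> - \<mu> \<theta>\<^sub>0) / 2\<close> plus a term without \<open>\<theta>\<close> (\<open>contrast_eq\<close>). The form
  \<open>B\<close> is positive semidefinite, and it is bounded for the total variation norm: the path of \<open>Z\<close> is
  bounded by some constant with probability above one half, and for normal variables this controls the
  variance (\<open>variance_bound\<close>).

  The asymptotics hold for each sample separately. Identifiability, regularity of \<open>\<Sigma>\<close> and
  compactness of \<open>\<Theta>\<close> give \<open>B (\<mu> \<theta> - \<mu> \<theta>\<^sub>0) (\<mu> \<theta> - \<mu> \<theta>\<^sub>0) \<ge> \<kappa> |\<theta> - \<theta>\<^sub>0|\<^sup>2\<close> on all of \<open>\<Theta>\<close>, while the linear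
  term is at most \<open>\<epsilon> L |\<theta> - \<theta>\<^sub>0|\<close> times twice the sup norm of the path (\<open>global_bounds\<close>). Hence the
  rescaled maximizer \<open>u = (\<theta> - \<theta>\<^sub>0) / \<epsilon>\<close> stays bounded. On bounded sets of \<open>u\<close>, differentiability
  at \<open>\<theta>\<^sub>0\<close> makes the objective, divided by \<open>\<epsilon>\<^sup>2\<close>, converge to \<open>u \<bullet> g - u \<bullet> (\<Sigma> u) / 2\<close> with
  \<open>g = \<langle>\<nabla> \<mu> \<theta>\<^sub>0, Z\<rangle>\<close>. That function has the maximizer \<open>\<Sigma>\<^sup>-\<^sup>1 g\<close> with quadratic growth around it, so \<open>u\<close>
  is close to it (\<open>argmax_asymptotics\<close>). The estimate is uniform over the samples whose path has sup
  norm at most \<open>R\<close>, and such samples have probability tending to 1 as \<open>R\<close> grows. This yields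
  convergence in probability, whether or not the maximizers depend measurably on the sample.

  Linear functionals of the limit are of the form \<open>\<langle>\<nu>, Z\<rangle>\<close> with a combination \<open>\<nu>\<close> of the partial
  derivatives, hence centered normal, and their variance is read off from \<open>B\<close>.
\<close>

section \<open>The pairing of signed measures with bounded Borel functions\<close>

lemma finite_measure_pos_part: "finite_measure (pos_part \<mu>)"
  by (rule finite_measureI) (simp add: emeasure_pos_part)

lemma measure_pos_part_le: "measure (pos_part \<mu>) A \<le> norm \<mu>"
proof (cases "A \<in> sets borel")
  case True
  have "upper_variation \<mu> A \<le> total_variation \<mu>"
    using abs_smeasure_le[of \<mu>] by (intro upper_variation_le) (auto dest: abs_le_D1)
  then show ?thesis
    using True by (simp add: measure_def emeasure_pos_part upper_variation_nonneg norm_signed_measure_def)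
qed (simp add: measure_notin_sets)

lemma smeasure_linear:
  "smeasure (\<mu> + \<nu>) A = smeasure \<mu> A + smeasure \<nu> A"
  "smeasure (\<mu> - \<nu>) A = smeasure \<mu> A - smeasure \<nu> A"
  "smeasure (c *\<^sub>R \<mu>) A = c * smeasure \<mu> A"
  "smeasure (- \<mu>) A = - smeasure \<mu> A"
  by (simp_all add: plus_signed_measure.rep_eq minus_signed_measure.rep_eq
      scaleR_signed_measure.rep_eq uminus_signed_measure.rep_eq)

lemma bounded_linear_smeasure: "bounded_linear (\<lambda>\<mu>. smeasure \<mu> A)"
  by (rule bounded_linear_intro[where K = 1])
    (auto simp: smeasure_linear norm_signed_measure_def abs_smeasure_le)

lemma subspace_signed_measures_on: "subspace (signed_measures_on T)"
  by (auto simp: subspace_def signed_measures_on_def smeasure_linear zero_signed_measure.rep_eq)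

text \<open>Bounded Borel functions on \<open>T\<close>, with which every signed measure can be paired; values off \<open>T\<close>
  are ignored.\<close>

definition bounded_borel_on :: "real set \<Rightarrow> (real \<Rightarrow> real) \<Rightarrow> bool" where
  "bounded_borel_on T x \<longleftrightarrow> set_borel_measurable borel T x \<and> (\<exists>c. \<forall>t\<in>T. \<bar>x t\<bar> \<le> c)"

lemma bounded_borel_onI:
  "set_borel_measurable borel T x \<Longrightarrow> (\<And>t. t \<in> T \<Longrightarrow> \<bar>x t\<bar> \<le> c) \<Longrightarrow> bounded_borel_on T x"
  by (auto simp: bounded_borel_on_def)

lemma bounded_borel_on_cong:
  assumes "\<And>t. t \<in> T \<Longrightarrow> x t = y t"
  shows "bounded_borel_on T x \<longleftrightarrow> bounded_borel_on T y"
proof -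
  have "(\<lambda>t. indicator T t *\<^sub>R x t) = (\<lambda>t. indicator T t *\<^sub>R y t)"
    using assms by (auto simp: indicator_def)
  then show ?thesis
    using assms by (simp add: bounded_borel_on_def set_borel_measurable_def)
qed

lemma bounded_borel_on_set_integrable:
  assumes "bounded_borel_on T x"
  shows "set_integrable (pos_part \<mu>) T x"
proof -
  interpret finite_measure "pos_part \<mu>" by (rule finite_measure_pos_part)
  obtain c where c: "\<And>t. t \<in> T \<Longrightarrow> \<bar>x t\<bar> \<le> c"
    using assms by (auto simp: bounded_borel_on_def)
  show ?thesis
    unfolding set_integrable_def
    using assms c
    by (intro integrable_const_bound[where B = "\<bar>c\<bar>"])
      (auto simp: bounded_borel_on_def set_borel_measurable_def indicator_def
        measurable_cong_sets[OF sets_pos_part refl]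
        intro: order_trans[OF _ abs_ge_self])
qed

lemma abs_set_integral_pos_part_le:
  assumes "bounded_borel_on T x" and c: "\<And>t. t \<in> T \<Longrightarrow> \<bar>x t\<bar> \<le> c" "0 \<le> c"
  shows "\<bar>LINT t:T|pos_part \<mu>. x t\<bar> \<le> c * norm \<mu>"
proof -
  interpret finite_measure "pos_part \<mu>" by (rule finite_measure_pos_part)
  have "\<bar>LINT t:T|pos_part \<mu>. x t\<bar> \<le> (LINT t|pos_part \<mu>. \<bar>indicator T t *\<^sub>R x t\<bar>)"
    unfolding set_lebesgue_integral_def by (rule integral_abs_bound)
  also have "\<dots> \<le> (LINT t|pos_part \<mu>. c)"
    using bounded_borel_on_set_integrable[OF assms(1), of \<mu>] c
    unfolding set_integrable_def
    by (intro integral_mono) (auto simp: indicator_def)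
  also have "\<dots> = c * measure (pos_part \<mu>) UNIV" by simp
  also have "\<dots> \<le> c * norm \<mu>"
    by (intro mult_left_mono measure_pos_part_le c)
  finally show ?thesis .
qed

text \<open>The factor 2 comes from bounding the two parts of the Jordan decomposition separately; the
  sharp constant is not needed.\<close>

lemma abs_pairing_le:
  assumes "bounded_borel_on T x" and c: "\<And>t. t \<in> T \<Longrightarrow> \<bar>x t\<bar> \<le> c" "0 \<le> c"
  shows "\<bar>pairing T \<mu> x\<bar> \<le> 2 * c * norm \<mu>"
  using abs_set_integral_pos_part_le[OF assms, of \<mu>] abs_set_integral_pos_part_le[OF assms, of "- \<mu>"]
  by (simp add: pairing_def neg_part_def)

lemma pairing_cong: "(\<And>t. t \<in> T \<Longrightarrow> x t = y t) \<Longrightarrow> pairing T \<mu> x = pairing T \<mu> y"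
  unfolding pairing_def set_lebesgue_integral_def
  by (auto intro!: arg_cong2[where f = minus] Bochner_Integration.integral_cong simp: indicator_def)

lemma pairing_add_fun:
  assumes "bounded_borel_on T x" "bounded_borel_on T y"
  shows "pairing T \<mu> (\<lambda>t. x t + y t) = pairing T \<mu> x + pairing T \<mu> y"
  using assms[THEN bounded_borel_on_set_integrable, of \<mu>]
    assms[THEN bounded_borel_on_set_integrable, of "- \<mu>"]
  by (simp add: pairing_def neg_part_def set_integral_add)

lemma pairing_scale_fun: "pairing T \<mu> (\<lambda>t. k * x t) = k * pairing T \<mu> x"
  by (simp add: pairing_def right_diff_distrib)

lemma pairing_indicator:
  assumes "A \<in> sets borel" "T \<in> sets borel"
  shows "pairing T \<mu> (indicator A) = smeasure \<mu> (A \<inter> T)"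
proof -
  have "(LINT t:T|pos_part \<mu>. indicator A t) = measure (pos_part \<mu>) (A \<inter> T)" for \<mu>
    unfolding set_lebesgue_integral_def by (simp add: indicator_inter_arith[symmetric] Int_commute)
  then show ?thesis
    using assms by (simp add: pairing_def neg_part_def smeasure_eq_pos_part_minus_neg_part)
qed

lemma pairing_LIMSEQ:
  assumes T: "T \<in> sets borel" and U: "\<And>i. U i \<in> borel_measurable borel" "x \<in> borel_measurable borel"
    and c: "\<And>i t. \<bar>U i t\<bar> \<le> c" and lim: "\<And>t. (\<lambda>i. U i t) \<longlonglongrightarrow> x t"
  shows "(\<lambda>i. pairing T \<mu> (U i)) \<longlonglongrightarrow> pairing T \<mu> x"
proof -
  have "(\<lambda>i. LINT t:T|pos_part \<mu>. U i t) \<longlonglongrightarrow> (LINT t:T|pos_part \<mu>. x t)" for \<mu>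
  proof -
    interpret finite_measure "pos_part \<mu>" by (rule finite_measure_pos_part)
    note [measurable] = U T
    have "0 \<le> c" using c[of 0 0] by linarith
    then show ?thesis
      unfolding set_lebesgue_integral_def using c
      by (intro integral_dominated_convergence[where w = "\<lambda>_. c"])
        (auto simp: indicator_def intro!: lim)
  qed
  then show ?thesis
    unfolding pairing_def neg_part_def by (intro tendsto_diff)
qed

lemma bounded_borel_on_const_bound:
  "T \<in> sets borel \<Longrightarrow> x \<in> borel_measurable borel \<Longrightarrow> (\<And>t. \<bar>x t\<bar> \<le> c) \<Longrightarrow> bounded_borel_on T x"
  by (rule bounded_borel_onI) (auto simp: set_borel_measurable_def)

text \<open>Linearity of the pairing in the measure is not immediate, because the Jordan decomposition is
  not additive. It holds for indicators by definition of the vector operations, and passes to all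
  bounded Borel functions by the monotone class induction: both sides are linear and continuous
  under bounded pointwise limits.\<close>

lemma pairing_lincomb_eq_0:
  fixes \<mu> :: "'i \<Rightarrow> signed_measure"
  assumes I: "finite I" and sum0: "(\<Sum>i\<in>I. c i *\<^sub>R \<mu> i) = 0"
    and T: "T \<in> sets borel" and x: "bounded_borel_on T x"
  shows "(\<Sum>i\<in>I. c i * pairing T (\<mu> i) x) = 0"
proof -
  have sm: "(\<Sum>i\<in>I. c i * smeasure (\<mu> i) A) = 0" for A
  proof -
    interpret bounded_linear "\<lambda>\<nu>. smeasure \<nu> A" by (rule bounded_linear_smeasure)
    show ?thesis
      using arg_cong[OF sum0, of "\<lambda>\<nu>. smeasure \<nu> A"] by (simp add: sum scaleR zero_signed_measure.rep_eq)
  qed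
  have nonneg: "(\<Sum>i\<in>I. c i * pairing T (\<mu> i) y) = 0"
    if ym: "y \<in> borel_measurable borel" and "\<And>t. 0 \<le> y t" and "\<And>t. y t \<le> d" for y d
    using that
  proof (induction y arbitrary: d rule: borel_measurable_induct_real)
    case (set A)
    then show ?case using T by (simp add: pairing_indicator sm)
  next
    case (mult u k)
    show ?case
    proof (cases "k = 0")
      case False
      then have "u t \<le> d / k" for t
        using mult.prems[of t] mult.hyps(1) by (simp add: field_simps)
      from mult.IH[OF this] show ?thesis
        by (simp add: pairing_scale_fun mult.left_commute[of _ k] sum_distrib_left[symmetric])
    qed (simp add: pairing_scale_fun[where k = 0, simplified])
  next
    case (add u v)
    have le: "u t \<le> d" "v t \<le> d" for t
      using add.prems[of t] add.hyps(2)[of t] add.hyps(4)[of t] by auto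
    have "bounded_borel_on T u" "bounded_borel_on T v"
      using le add.hyps T by (auto intro!: bounded_borel_on_const_bound[where c = d])
    then show ?case
      using add.IH(1)[OF le(1)] add.IH(2)[OF le(2)]
      by (simp add: pairing_add_fun distrib_left sum.distrib)
  next
    case (seq U)
    have le: "U i t \<le> y t" for i t
      using seq.hyps(3,4) by (intro incseq_le[of "\<lambda>i. U i t"]) (auto simp: incseq_def le_fun_def)
    have bd: "\<bar>U i t\<bar> \<le> d" for i t
      using le[of i t] seq.prems[of t] seq.hyps(2)[of i t] by simp
    have "(\<lambda>i. \<Sum>j\<in>I. c j * pairing T (\<mu> j) (U i)) \<longlonglongrightarrow> (\<Sum>j\<in>I. c j * pairing T (\<mu> j) y)"
      using seq.hyps(1,4) ym bd T
      by (intro tendsto_sum tendsto_mult tendsto_const pairing_LIMSEQ) auto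
    moreover have "(\<Sum>j\<in>I. c j * pairing T (\<mu> j) (U i)) = 0" for i
      using seq.IH[of i d] seq.hyps(1,2) bd by (auto dest: abs_le_D1)
    ultimately show ?case
      by (simp add: LIMSEQ_const_iff)
  qed
  \<comment> \<open>Adding a constant reduces the general case to nonnegative functions.\<close>
  obtain d where d: "\<And>t. t \<in> T \<Longrightarrow> \<bar>x t\<bar> \<le> d"
    using x by (auto simp: bounded_borel_on_def)
  define y where "y t = indicator T t * x t" for t
  have y: "y \<in> borel_measurable borel" "\<And>t. \<bar>y t\<bar> \<le> \<bar>d\<bar>"
    using x d by (auto simp: y_def[abs_def] bounded_borel_on_def set_borel_measurable_def indicator_def
        intro: order_trans[OF _ abs_ge_self])
  have bb: "bounded_borel_on T y" "bounded_borel_on T (\<lambda>_. \<bar>d\<bar>)"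
    using y T by (auto intro!: bounded_borel_on_const_bound[where c = "\<bar>d\<bar>"])
  have "0 \<le> y t + \<bar>d\<bar> \<and> y t + \<bar>d\<bar> \<le> 2 * \<bar>d\<bar>" for t
    using y(2)[of t] by linarith
  then have "(\<Sum>i\<in>I. c i * pairing T (\<mu> i) (\<lambda>t. y t + \<bar>d\<bar>)) = 0"
    using y(1) by (intro nonneg[where d = "2 * \<bar>d\<bar>"]) auto
  moreover have "(\<Sum>i\<in>I. c i * pairing T (\<mu> i) (\<lambda>_. \<bar>d\<bar>)) = 0"
    by (intro nonneg[where d = "\<bar>d\<bar>"]) auto
  ultimately have "(\<Sum>i\<in>I. c i * pairing T (\<mu> i) y) = 0"
    by (simp add: pairing_add_fun[OF bb] distrib_left sum.distrib)
  moreover have "pairing T (\<mu> i) x = pairing T (\<mu> i) y" for i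
    by (rule pairing_cong) (simp add: y_def)
  ultimately show ?thesis by simp
qed

lemma linear_pairing:
  assumes "T \<in> sets borel" "bounded_borel_on T x"
  shows "linear (\<lambda>\<mu>. pairing T \<mu> x)"
proof (rule linearI)
  fix \<mu> \<nu> :: signed_measure and r :: real
  show "pairing T (\<mu> + \<nu>) x = pairing T \<mu> x + pairing T \<nu> x"
    using pairing_lincomb_eq_0[of "{..<3::nat}" "(!) [1, -1, -1]" "(!) [\<mu> + \<nu>, \<mu>, \<nu>]" T x] assms
    by (simp add: eval_nat_numeral)
  show "pairing T (r *\<^sub>R \<mu>) x = r *\<^sub>R pairing T \<mu> x"
    using pairing_lincomb_eq_0[of "{..<2::nat}" "(!) [1, -r]" "(!) [r *\<^sub>R \<mu>, \<mu>]" T x] assms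
    by (simp add: eval_nat_numeral)
qed

text \<open>The unit mass at \<open>s\<close>, as a signed measure.\<close>

lift_definition dirac :: "real \<Rightarrow> signed_measure" is "\<lambda>s A. if A \<in> sets borel then indicator A s else 0"
proof -
  fix s :: real
  interpret prob_space "return borel s" by (rule prob_space_return) simp
  have "(\<lambda>n. measure (return borel s) (F n)) sums measure (return borel s) (\<Union>n. F n)"
    if "range F \<subseteq> sets borel" "disjoint_family F" for F
    using that by (intro finite_measure_UNION) auto
  then show "countably_additive_real (\<lambda>A. if A \<in> sets borel then indicator A s else 0) \<and>
      (\<forall>A. A \<notin> sets borel \<longrightarrow> (if A \<in> sets borel then indicator A s else 0) = (0::real))"
    by (auto simp: countably_additive_real_def measure_return range_subsetD)
qed

lemma upper_variation_dirac:
  assumes "A \<in> sets borel"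
  shows "upper_variation (dirac s) A = indicator A s" "upper_variation (- dirac s) A = 0"
proof (rule antisym)
  show "upper_variation (dirac s) A \<le> indicator A s"
    by (rule upper_variation_le) (auto simp: dirac.rep_eq indicator_def)
  show "indicator A s \<le> upper_variation (dirac s) A"
    using smeasure_le_upper_variation[of A A "dirac s"] assms by (simp add: dirac.rep_eq)
  show "upper_variation (- dirac s) A = 0"
    by (intro antisym upper_variation_le upper_variation_nonneg)
      (auto simp: dirac.rep_eq smeasure_linear)
qed

lemma pairing_dirac:
  assumes "s \<in> T" "set_borel_measurable borel T x"
  shows "pairing T (dirac s) x = x s"
proof -
  have "pos_part (dirac s) = return borel s" "neg_part (dirac s) = null_measure borel"
    by (auto intro!: measure_eqI simp: neg_part_def emeasure_pos_part upper_variation_dirac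
        ennreal_indicator)
  then show ?thesis
    using assms by (simp add: pairing_def set_lebesgue_integral_def set_borel_measurable_def integral_return)
qed

lemma dirac_in_signed_measures_on: "s \<in> T \<Longrightarrow> dirac s \<in> signed_measures_on T"
  by (auto simp: signed_measures_on_def dirac.rep_eq indicator_def)

section \<open>Centered normal variables\<close>

lemma normal_rv_0_moments:
  assumes "prob_space M" and X: "normal_rv M X 0 v"
  shows "X \<in> borel_measurable M" "integrable M (\<lambda>\<omega>. (X \<omega>)\<^sup>2)"
    "(LINT \<omega>|M. X \<omega>) = 0" "(LINT \<omega>|M. (X \<omega>)\<^sup>2) = v"
proof -
  show Xm [measurable]: "X \<in> borel_measurable M" using X by (simp add: normal_rv_def)
  have v: "0 \<le> v" and law: "distr M borel X = normal_law 0 v"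
    using X by (simp_all add: normal_rv_def)
  have int: "(LINT \<omega>|M. f (X \<omega>)) = (LINT x|normal_law 0 v. f x)"
      "integrable M (\<lambda>\<omega>. f (X \<omega>)) \<longleftrightarrow> integrable (normal_law 0 v) f"
    if "f \<in> borel_measurable borel" for f :: "real \<Rightarrow> real"
    unfolding law[symmetric] using that by (simp_all add: integral_distr integrable_distr_eq)
  have "integrable (normal_law 0 v) (\<lambda>x. x\<^sup>2) \<and> (LINT x|normal_law 0 v. x) = 0
      \<and> (LINT x|normal_law 0 v. x\<^sup>2) = v"
  proof (cases "v = 0")
    case True
    interpret prob_space "return borel (0::real)" by (rule prob_space_return) simp
    have ae: "AE x in return borel (0::real). x = 0" by (simp add: AE_return)
    have "integrable (return borel (0::real)) (\<lambda>x. x\<^sup>2)"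
      using ae by (intro integrable_const_bound[where B = 0]) auto
    then show ?thesis using True by (simp add: normal_law_def integral_return)
  next
    case False
    with v have s: "0 < sqrt v" by simp
    have "integrable lborel (\<lambda>x. normal_density 0 (sqrt v) x * x\<^sup>2)"
      using integrable_normal_moment[OF s, of 0 2] by simp
    moreover have "(\<integral>x. normal_density 0 (sqrt v) x * x \<partial>lborel) = 0"
      using integral_normal_moment_nz_1[OF s, of 0] by simp
    moreover have "(\<integral>x. normal_density 0 (sqrt v) x * x\<^sup>2 \<partial>lborel) = v"
      using integral_normal_moment_even[OF s, of 0 1] v by (simp add: fact_numeral)
    ultimately show ?thesis
      using False by (simp add: normal_law_def integrable_density integral_density)
  qed
  then show "integrable M (\<lambda>\<omega>. (X \<omega>)\<^sup>2)" "(LINT \<omega>|M. X \<omega>) = 0" "(LINT \<omega>|M. (X \<omega>)\<^sup>2) = v"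
    using int[of "\<lambda>x. x\<^sup>2"] int[of "\<lambda>x. x"] by auto
qed

text \<open>A centered normal variable that lies in \<open>[-R, R]\<close> with probability at least one half has a
  variance of order \<open>R\<^sup>2\<close>, because its density is at most \<open>1 / sqrt (2 * pi * v)\<close>.\<close>

lemma normal_rv_0_variance_le:
  assumes "prob_space M" and X: "normal_rv M X 0 v"
    and R: "0 \<le> R" "1 / 2 \<le> measure M {\<omega>\<in>space M. \<bar>X \<omega>\<bar> \<le> R}"
  shows "v \<le> 4 * R\<^sup>2"
proof (cases "v = 0")
  case False
  with X have v: "0 < v" and law: "distr M borel X = density lborel (normal_density 0 (sqrt v))"
    and Xm [measurable]: "X \<in> borel_measurable M"
    by (auto simp: normal_rv_def normal_law_def)
  interpret prob_space M by fact
  have "{\<omega>\<in>space M. \<bar>X \<omega>\<bar> \<le> R} = X -` {-R..R} \<inter> space M" by auto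
  then have "emeasure M {\<omega>\<in>space M. \<bar>X \<omega>\<bar> \<le> R} = emeasure (distr M borel X) {-R..R}"
    by (simp add: emeasure_distr)
  also have "\<dots> = (\<integral>\<^sup>+x. ennreal (normal_density 0 (sqrt v) x) * indicator {-R..R} x \<partial>lborel)"
    unfolding law by (simp add: emeasure_density)
  also have "\<dots> \<le> (\<integral>\<^sup>+x. ennreal (1 / sqrt (2 * pi * v)) * indicator {-R..R} x \<partial>lborel)"
    using v by (intro nn_integral_mono mult_right_mono ennreal_leI)
      (auto simp: normal_density_def intro!: divide_right_mono)
  also have "\<dots> = ennreal (1 / sqrt (2 * pi * v) * (2 * R))"
  proof -
    have "emeasure lborel {-R..R} = ennreal (2 * R)" using R by simp
    then show ?thesis
      using v R ennreal_mult[of "1 / sqrt (2 * pi * v)" "2 * R"]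
      by (subst nn_integral_cmult_indicator) auto
  qed
  finally have "prob {\<omega>\<in>space M. \<bar>X \<omega>\<bar> \<le> R} \<le> 1 / sqrt (2 * pi * v) * (2 * R)"
    using R v by (simp add: emeasure_eq_measure)
  with R have "1 / 2 \<le> 1 / sqrt (2 * pi * v) * (2 * R)" by linarith
  then have "sqrt (2 * pi * v) \<le> 4 * R"
    using v by (simp add: field_simps)
  then have "(sqrt (2 * pi * v))\<^sup>2 \<le> (4 * R)\<^sup>2"
    using v by (intro power_mono) auto
  then have "2 * pi * v \<le> 16 * R\<^sup>2"
    using v by (simp add: power_mult_distrib)
  moreover have "4 * v \<le> 2 * pi * v"
    using v pi_ge_two by (intro mult_right_mono) auto
  ultimately show ?thesis by linarith
qed simp

section \<open>Paths of a Gaussian vector\<close>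

text \<open>A centered Gaussian vector in \<open>C[a, b]\<close>.\<close>

locale gaussian_path = prob_space M for M :: "'w measure" +
  fixes a b :: real and Z :: "'w \<Rightarrow> real \<Rightarrow> real"
  assumes a_le_b: "a \<le> b" and gaussian: "centered_gaussian_vector M {a..b} Z"
begin

lemma continuous_path:
  assumes "\<omega> \<in> space M"
  shows "continuous_on {a..b} (Z \<omega>)"
proof -
  have "Z \<omega> \<in> space (C_borel {a..b})"
    using gaussian assms by (auto simp: centered_gaussian_vector_def dest: measurable_space)
  then show ?thesis
    by (simp add: C_borel_def space_measure_of_conv C_space_def)
qed

lemma bounded_borel_path: "\<omega> \<in> space M \<Longrightarrow> bounded_borel_on {a..b} (Z \<omega>)"
  using compact_imp_bounded[OF compact_continuous_image[OF continuous_path compact_Icc]]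
    borel_measurable_continuous_on_indicator[OF _ continuous_path]
  by (auto simp: bounded_borel_on_def set_borel_measurable_def bounded_iff)

lemma normal_pairing:
  assumes "\<nu> \<in> signed_measures_on {a..b}"
  shows "normal_rv M (\<lambda>\<omega>. pairing {a..b} \<nu> (Z \<omega>)) 0 (LINT \<omega>|M. (pairing {a..b} \<nu> (Z \<omega>))\<^sup>2)"
proof -
  obtain v where v: "normal_rv M (\<lambda>\<omega>. pairing {a..b} \<nu> (Z \<omega>)) 0 v"
    using gaussian assms by (auto simp: centered_gaussian_vector_def)
  then show ?thesis
    using normal_rv_0_moments(4)[OF prob_space_axioms v] by simp
qed

lemmas pairing_measurable = normal_rv_0_moments(1)[OF prob_space_axioms normal_pairing]
lemmas pairing_square_integrable = normal_rv_0_moments(2)[OF prob_space_axioms normal_pairing]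

text \<open>The coordinate \<open>Z\<^sub>t\<close> is the pairing with the unit mass at \<open>t\<close>, hence centered normal.\<close>

lemma normal_path:
  assumes "t \<in> {a..b}"
  shows "normal_rv M (\<lambda>\<omega>. Z \<omega> t) 0 (LINT \<omega>|M. (Z \<omega> t)\<^sup>2)"
proof -
  have eq: "pairing {a..b} (dirac t) (Z \<omega>) = Z \<omega> t" if "\<omega> \<in> space M" for \<omega>
    using bounded_borel_path[OF that] assms by (intro pairing_dirac) (auto simp: bounded_borel_on_def)
  have "normal_rv M (\<lambda>\<omega>. pairing {a..b} (dirac t) (Z \<omega>)) 0 (LINT \<omega>|M. (pairing {a..b} (dirac t) (Z \<omega>))\<^sup>2)"
    by (rule normal_pairing[OF dirac_in_signed_measures_on[OF assms]])
  moreover have "(LINT \<omega>|M. (pairing {a..b} (dirac t) (Z \<omega>))\<^sup>2) = (LINT \<omega>|M. (Z \<omega> t)\<^sup>2)"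
    by (rule Bochner_Integration.integral_cong) (simp_all add: eq)
  moreover have "distr M borel (\<lambda>\<omega>. pairing {a..b} (dirac t) (Z \<omega>)) = distr M borel (\<lambda>\<omega>. Z \<omega> t)"
    by (rule distr_cong) (simp_all add: eq)
  moreover have "(\<lambda>\<omega>. pairing {a..b} (dirac t) (Z \<omega>)) \<in> borel_measurable M \<longleftrightarrow> (\<lambda>\<omega>. Z \<omega> t) \<in> borel_measurable M"
    by (rule measurable_cong) (simp add: eq)
  ultimately show ?thesis by (simp add: normal_rv_def)
qed

lemmas path_measurable = normal_rv_0_moments(1)[OF prob_space_axioms normal_path]
lemmas path_square_integrable = normal_rv_0_moments(2)[OF prob_space_axioms normal_path]
lemmas path_mean = normal_rv_0_moments(3)[OF prob_space_axioms normal_path]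

text \<open>Points \<open>i / (n + 1)\<close>, clipped to \<open>[a, b]\<close>. Paths are determined by their values on this
  countable set, which reduces measurability questions about whole paths to single coordinates.\<close>

definition grid_point :: "nat \<Rightarrow> int \<Rightarrow> real" where
  "grid_point n i = max a (min b (of_int i / real (Suc n)))"

lemma grid_point_in: "grid_point n i \<in> {a..b}"
  using a_le_b by (auto simp: grid_point_def)

lemma grid_point_LIMSEQ:
  assumes "t \<in> {a..b}"
  shows "(\<lambda>n. grid_point n \<lfloor>real (Suc n) * t\<rfloor>) \<longlonglongrightarrow> t"
proof -
  have "(\<lambda>n. of_int \<lfloor>real (Suc n) * t\<rfloor> / real (Suc n)) \<longlonglongrightarrow> t"
  proof (rule tendsto_sandwich)
    show "\<forall>\<^sub>F n in sequentially. t - inverse (real (Suc n)) \<le> of_int \<lfloor>real (Suc n) * t\<rfloor> / real (Suc n)"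
    proof (intro always_eventually allI)
      fix n
      have "real (Suc n) * t - 1 \<le> of_int \<lfloor>real (Suc n) * t\<rfloor>" by linarith
      then have "(real (Suc n) * t - 1) / real (Suc n) \<le> of_int \<lfloor>real (Suc n) * t\<rfloor> / real (Suc n)"
        by (rule divide_right_mono) simp
      then show "t - inverse (real (Suc n)) \<le> of_int \<lfloor>real (Suc n) * t\<rfloor> / real (Suc n)"
        by (simp add: diff_divide_distrib inverse_eq_divide del: of_nat_Suc)
    qed
    show "\<forall>\<^sub>F n in sequentially. of_int \<lfloor>real (Suc n) * t\<rfloor> / real (Suc n) \<le> t"
    proof (intro always_eventually allI)
      fix n
      have "of_int \<lfloor>real (Suc n) * t\<rfloor> \<le> real (Suc n) * t" by linarith
      then show "of_int \<lfloor>real (Suc n) * t\<rfloor> / real (Suc n) \<le> t"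
        by (simp add: field_simps del: of_nat_Suc)
    qed
    show "(\<lambda>n. t - inverse (real (Suc n))) \<longlonglongrightarrow> t"
      using tendsto_diff[OF tendsto_const LIMSEQ_inverse_real_of_nat, of t] by simp
  qed simp
  then have "(\<lambda>n. grid_point n \<lfloor>real (Suc n) * t\<rfloor>) \<longlonglongrightarrow> max a (min b t)"
    unfolding grid_point_def by (intro tendsto_max tendsto_min tendsto_const)
  then show ?thesis using assms by (simp add: min_absorb2 max_absorb2)
qed

lemma path_grid_LIMSEQ:
  assumes "\<omega> \<in> space M" "t \<in> {a..b}"
  shows "(\<lambda>n. Z \<omega> (grid_point n \<lfloor>real (Suc n) * t\<rfloor>)) \<longlonglongrightarrow> Z \<omega> t"
  using continuous_path[OF assms(1)] assms(2) grid_point_in grid_point_LIMSEQ[OF assms(2)]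
  by (intro continuous_on_tendsto_compose[of "{a..b}" "Z \<omega>"]) auto

lemma path_jointly_measurable:
  "(\<lambda>(t, \<omega>). indicator {a..b} t * Z \<omega> t) \<in> borel_measurable (borel \<Otimes>\<^sub>M M)"
proof -
  have "(\<lambda>p. indicator {a..b} (fst p) * Z (snd p) (fst p)) \<in> borel_measurable (borel \<Otimes>\<^sub>M M)"
  proof (rule borel_measurable_LIMSEQ_real)
    fix p :: "real \<times> 'w" assume "p \<in> space (borel \<Otimes>\<^sub>M M)"
    then show "(\<lambda>n. indicator {a..b} (fst p) * Z (snd p) (grid_point n \<lfloor>real (Suc n) * fst p\<rfloor>))
        \<longlonglongrightarrow> indicator {a..b} (fst p) * Z (snd p) (fst p)"
      using path_grid_LIMSEQ[of "snd p" "fst p"]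
      by (cases "fst p \<in> {a..b}") (auto simp: space_pair_measure)
  next
    fix n
    note [measurable] = path_measurable[OF grid_point_in]
    have "(\<lambda>p. Z (snd p) (grid_point n \<lfloor>real (Suc n) * fst p\<rfloor>)) \<in> borel_measurable (borel \<Otimes>\<^sub>M M)"
      by (rule measurable_compose_countable[where f = "\<lambda>i p. Z (snd p) (grid_point n i)"]) measurable
    then show "(\<lambda>p. indicator {a..b} (fst p) * Z (snd p) (grid_point n \<lfloor>real (Suc n) * fst p\<rfloor>))
        \<in> borel_measurable (borel \<Otimes>\<^sub>M M)"
      by measurable
  qed
  then show ?thesis by (simp add: split_def)
qed

text \<open>The event that the sup norm of the path is at most \<open>R\<close>.\<close>

definition paths_bounded_by :: "real \<Rightarrow> 'w set" where
  "paths_bounded_by R = {\<omega>\<in>space M. \<forall>t\<in>{a..b}. \<bar>Z \<omega> t\<bar> \<le> R}"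

lemma paths_bounded_by_sets: "paths_bounded_by R \<in> sets M"
proof -
  note [measurable] = path_measurable[OF grid_point_in]
  have "\<bar>Z \<omega> t\<bar> \<le> R" if "\<omega> \<in> space M" "t \<in> {a..b}" "\<forall>n i. \<bar>Z \<omega> (grid_point n i)\<bar> \<le> R" for \<omega> t
    using tendsto_rabs[OF path_grid_LIMSEQ[OF that(1,2)]] that(3) by (intro LIMSEQ_le_const2) auto
  then have "paths_bounded_by R = {\<omega>\<in>space M. \<forall>n i. \<bar>Z \<omega> (grid_point n i)\<bar> \<le> R}"
    using grid_point_in by (auto simp: paths_bounded_by_def)
  also have "\<dots> \<in> sets M" by measurable
  finally show ?thesis .
qed

lemma prob_paths_bounded_by_LIMSEQ: "(\<lambda>n. prob (paths_bounded_by (real n))) \<longlonglongrightarrow> 1"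
proof -
  have "(\<lambda>n. prob (paths_bounded_by (real n))) \<longlonglongrightarrow> prob (\<Union>n. paths_bounded_by (real n))"
  proof (rule finite_Lim_measure_incseq)
    show "range (\<lambda>n. paths_bounded_by (real n)) \<subseteq> sets M" using paths_bounded_by_sets by auto
    show "incseq (\<lambda>n. paths_bounded_by (real n))"
      unfolding incseq_def
    proof (intro allI impI subsetI)
      fix m n :: nat and \<omega> assume "m \<le> n" "\<omega> \<in> paths_bounded_by (real m)"
      then show "\<omega> \<in> paths_bounded_by (real n)"
        using order_trans[OF _ of_nat_mono] by (auto simp: paths_bounded_by_def)
    qed
  qed
  moreover have "\<exists>n. \<omega> \<in> paths_bounded_by (real n)" if \<omega>: "\<omega> \<in> space M" for \<omega>
  proof -
    obtain c where c: "\<And>t. t \<in> {a..b} \<Longrightarrow> \<bar>Z \<omega> t\<bar> \<le> c"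
      using bounded_borel_path[OF \<omega>] unfolding bounded_borel_on_def by blast
    obtain n where "c \<le> real n" using real_arch_simple by blast
    with c have "\<bar>Z \<omega> t\<bar> \<le> real n" if "t \<in> {a..b}" for t
      using that order_trans by blast
    with \<omega> show ?thesis by (intro exI[of _ n]) (simp add: paths_bounded_by_def)
  qed
  then have "(\<Union>n. paths_bounded_by (real n)) = space M"
    by (auto simp: paths_bounded_by_def)
  ultimately show ?thesis by (simp add: prob_space)
qed

lemma abs_pairing_path_le:
  assumes "\<omega> \<in> paths_bounded_by R"
  shows "\<bar>pairing {a..b} \<nu> (Z \<omega>)\<bar> \<le> 2 * R * norm \<nu>"
proof (rule abs_pairing_le)
  have "\<bar>Z \<omega> a\<bar> \<le> R" using assms a_le_b by (simp add: paths_bounded_by_def)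
  then show "0 \<le> R" by linarith
qed (use assms bounded_borel_path in \<open>auto simp: paths_bounded_by_def\<close>)

text \<open>On an event of probability above one half the path is bounded by some \<open>n\<close>, so the pairing
  with \<open>\<nu>\<close> is bounded by a multiple of \<open>norm \<nu>\<close> there; as the pairing is normal, this already
  bounds its variance. No moment of the supremum of the path is needed.\<close>

lemma variance_bound:
  obtains C where "0 \<le> C"
    "\<And>\<nu>. \<nu> \<in> signed_measures_on {a..b} \<Longrightarrow> (LINT \<omega>|M. (pairing {a..b} \<nu> (Z \<omega>))\<^sup>2) \<le> C * (norm \<nu>)\<^sup>2"
    "\<And>t. t \<in> {a..b} \<Longrightarrow> (LINT \<omega>|M. (Z \<omega> t)\<^sup>2) \<le> C"
proof -
  have "\<forall>\<^sub>F n in sequentially. 1 / 2 < prob (paths_bounded_by (real n))"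
    using prob_paths_bounded_by_LIMSEQ by (rule order_tendstoD) simp
  then obtain n where n: "1 / 2 \<le> prob (paths_bounded_by (real n))"
    by (auto simp: eventually_sequentially intro: less_imp_le)
  have small_ball: "1 / 2 \<le> prob {\<omega>\<in>space M. \<bar>X \<omega>\<bar> \<le> r}"
    if [measurable]: "X \<in> borel_measurable M"
      and "\<And>\<omega>. \<omega> \<in> paths_bounded_by (real n) \<Longrightarrow> \<bar>X \<omega>\<bar> \<le> r" for X :: "'w \<Rightarrow> real" and r
  proof -
    have "prob (paths_bounded_by (real n)) \<le> prob {\<omega>\<in>space M. \<bar>X \<omega>\<bar> \<le> r}"
      using that(2)
      by (intro finite_measure_mono) (auto simp: paths_bounded_by_def)
    with n show ?thesis by linarith
  qed
  show thesis
  proof (rule that[of "16 * (real n)\<^sup>2"])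
    fix \<nu> assume \<nu>: "\<nu> \<in> signed_measures_on {a..b}"
    have "(LINT \<omega>|M. (pairing {a..b} \<nu> (Z \<omega>))\<^sup>2) \<le> 4 * (2 * real n * norm \<nu>)\<^sup>2"
      using abs_pairing_path_le
      by (intro normal_rv_0_variance_le[OF prob_space_axioms normal_pairing[OF \<nu>]]
          small_ball pairing_measurable[OF \<nu>]) auto
    then show "(LINT \<omega>|M. (pairing {a..b} \<nu> (Z \<omega>))\<^sup>2) \<le> 16 * (real n)\<^sup>2 * (norm \<nu>)\<^sup>2"
      by (simp add: power_mult_distrib)
  next
    fix t assume t: "t \<in> {a..b}"
    have "(LINT \<omega>|M. (Z \<omega> t)\<^sup>2) \<le> 4 * (real n)\<^sup>2"
      using t by (intro normal_rv_0_variance_le[OF prob_space_axioms normal_path[OF t]]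
          small_ball path_measurable) (auto simp: paths_bounded_by_def)
    then show "(LINT \<omega>|M. (Z \<omega> t)\<^sup>2) \<le> 16 * (real n)\<^sup>2"
      by (rule order_trans) (auto intro: mult_right_mono)
  qed simp
qed

end

section \<open>The covariance operator as a second moment\<close>

lemma (in prob_space) square_integrable_mult:
  fixes X Y :: "'a \<Rightarrow> real"
  assumes [measurable]: "X \<in> borel_measurable M" "Y \<in> borel_measurable M"
    and sq: "integrable M (\<lambda>\<omega>. (X \<omega>)\<^sup>2)" "integrable M (\<lambda>\<omega>. (Y \<omega>)\<^sup>2)"
  shows "integrable M (\<lambda>\<omega>. X \<omega> * Y \<omega>)"
    and "2 * (LINT \<omega>|M. \<bar>X \<omega> * Y \<omega>\<bar>) \<le> (LINT \<omega>|M. (X \<omega>)\<^sup>2) + (LINT \<omega>|M. (Y \<omega>)\<^sup>2)"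
proof -
  have le: "2 * \<bar>x * y\<bar> \<le> x\<^sup>2 + y\<^sup>2" for x y :: real
    using sum_squares_bound[of "\<bar>x\<bar>" "\<bar>y\<bar>"] by (simp add: abs_mult)
  have le': "\<bar>x * y\<bar> \<le> x\<^sup>2 + y\<^sup>2" for x y :: real
    using le[of x y] abs_ge_zero[of "x * y"] by linarith
  show int: "integrable M (\<lambda>\<omega>. X \<omega> * Y \<omega>)"
    by (rule Bochner_Integration.integrable_bound[OF Bochner_Integration.integrable_add[OF sq]])
      (auto simp: le' intro!: AE_I2 order_trans[OF le'])
  have "(LINT \<omega>|M. 2 * \<bar>X \<omega> * Y \<omega>\<bar>) \<le> (LINT \<omega>|M. (X \<omega>)\<^sup>2 + (Y \<omega>)\<^sup>2)"
    using int sq le by (intro integral_mono) auto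
  then show "2 * (LINT \<omega>|M. \<bar>X \<omega> * Y \<omega>\<bar>) \<le> (LINT \<omega>|M. (X \<omega>)\<^sup>2) + (LINT \<omega>|M. (Y \<omega>)\<^sup>2)"
    using sq by simp
qed

context gaussian_path
begin

lemma bounded_borel_cross_moment:
  assumes Y [measurable]: "Y \<in> borel_measurable M" and Y2: "integrable M (\<lambda>\<omega>. (Y \<omega>)\<^sup>2)"
  shows "bounded_borel_on {a..b} (\<lambda>t. LINT \<omega>|M. Y \<omega> * Z \<omega> t)"
proof -
  obtain C where C: "\<And>t. t \<in> {a..b} \<Longrightarrow> (LINT \<omega>|M. (Z \<omega> t)\<^sup>2) \<le> C"
    using variance_bound by blast
  note [measurable] = path_jointly_measurable
  have "(\<lambda>t. LINT \<omega>|M. Y \<omega> * (case (t, \<omega>) of (t, \<omega>) \<Rightarrow> indicator {a..b} t * Z \<omega> t))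
      \<in> borel_measurable borel"
    by measurable
  then have "set_borel_measurable borel {a..b} (\<lambda>t. LINT \<omega>|M. Y \<omega> * Z \<omega> t)"
    by (simp add: set_borel_measurable_def mult.left_commute[of "Y _"])
  moreover have "\<bar>LINT \<omega>|M. Y \<omega> * Z \<omega> t\<bar> \<le> (LINT \<omega>|M. (Y \<omega>)\<^sup>2) + C" if "t \<in> {a..b}" for t
  proof -
    have "\<bar>LINT \<omega>|M. Y \<omega> * Z \<omega> t\<bar> \<le> (LINT \<omega>|M. \<bar>Y \<omega> * Z \<omega> t\<bar>)"
      by (rule integral_abs_bound)
    moreover have "0 \<le> (LINT \<omega>|M. \<bar>Y \<omega> * Z \<omega> t\<bar>)" by simp
    moreover have "2 * (LINT \<omega>|M. \<bar>Y \<omega> * Z \<omega> t\<bar>) \<le> (LINT \<omega>|M. (Y \<omega>)\<^sup>2) + (LINT \<omega>|M. (Z \<omega> t)\<^sup>2)"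
      using that by (intro square_integrable_mult(2) Y Y2 path_measurable path_square_integrable)
    ultimately show ?thesis
      using C[OF that] by linarith
  qed
  ultimately show ?thesis by (rule bounded_borel_onI)
qed

text \<open>Stated for finite measures, to be applied to both parts of a Jordan decomposition.\<close>

lemma Fubini_path:
  assumes Y [measurable]: "Y \<in> borel_measurable M" and Y2: "integrable M (\<lambda>\<omega>. (Y \<omega>)\<^sup>2)"
    and "finite_measure N" and N [measurable_cong]: "sets N = sets borel"
  shows "(LINT t:{a..b}|N. LINT \<omega>|M. Y \<omega> * Z \<omega> t) = (LINT \<omega>|M. Y \<omega> * (LINT t:{a..b}|N. Z \<omega> t))"
    and "integrable M (\<lambda>\<omega>. Y \<omega> * (LINT t:{a..b}|N. Z \<omega> t))"
proof -
  interpret N: finite_measure N by fact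
  interpret NM: pair_sigma_finite N M ..
  obtain C where C: "\<And>t. t \<in> {a..b} \<Longrightarrow> (LINT \<omega>|M. (Z \<omega> t)\<^sup>2) \<le> C"
    using variance_bound by blast
  define f where "f = (\<lambda>(t, \<omega>). Y \<omega> * (case (t, \<omega>) of (t, \<omega>) \<Rightarrow> indicator {a..b} t * Z \<omega> t))"
  note [measurable] = path_jointly_measurable
  have f: "f \<in> borel_measurable (N \<Otimes>\<^sub>M M)"
    unfolding f_def by measurable
  have f_eq: "f (t, \<omega>) = indicator {a..b} t * (Y \<omega> * Z \<omega> t)" for t \<omega>
    by (simp add: f_def)
  have int: "integrable M (\<lambda>\<omega>. f (t, \<omega>))" for t
    using square_integrable_mult(1)[OF Y path_measurable Y2 path_square_integrable, of t]
    by (cases "t \<in> {a..b}") (auto simp: f_eq)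
  have "integrable N (\<lambda>t. LINT \<omega>|M. norm (f (t, \<omega>)))"
  proof (rule N.integrable_const_bound[where B = "\<bar>(LINT \<omega>|M. (Y \<omega>)\<^sup>2) + C\<bar>"])
    show "AE t in N. norm (LINT \<omega>|M. norm (f (t, \<omega>))) \<le> \<bar>(LINT \<omega>|M. (Y \<omega>)\<^sup>2) + C\<bar>"
    proof (rule AE_I2)
      fix t
      have "0 \<le> (LINT \<omega>|M. \<bar>Y \<omega> * Z \<omega> t\<bar>)" by simp
      then show "norm (LINT \<omega>|M. norm (f (t, \<omega>))) \<le> \<bar>(LINT \<omega>|M. (Y \<omega>)\<^sup>2) + C\<bar>"
        using square_integrable_mult(2)[OF Y path_measurable Y2 path_square_integrable, of t] C[of t]
        by (cases "t \<in> {a..b}") (auto simp: f_eq)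
    qed
    show "(\<lambda>t. LINT \<omega>|M. norm (f (t, \<omega>))) \<in> borel_measurable N"
      using f by measurable
  qed
  then have "integrable (N \<Otimes>\<^sub>M M) f"
    by (intro NM.Fubini_integrable f AE_I2 int) auto
  then have F: "integrable (N \<Otimes>\<^sub>M M) (\<lambda>(t, \<omega>). f (t, \<omega>))" by simp
  have inner: "(LINT t|N. f (t, \<omega>)) = Y \<omega> * (LINT t:{a..b}|N. Z \<omega> t)" for \<omega>
    by (simp add: f_eq set_lebesgue_integral_def mult.left_commute[of _ "Y \<omega>"])
  have outer: "(LINT t|N. LINT \<omega>|M. f (t, \<omega>)) = (LINT t:{a..b}|N. LINT \<omega>|M. Y \<omega> * Z \<omega> t)"
    by (simp add: f_eq set_lebesgue_integral_def)
  show "(LINT t:{a..b}|N. LINT \<omega>|M. Y \<omega> * Z \<omega> t) = (LINT \<omega>|M. Y \<omega> * (LINT t:{a..b}|N. Z \<omega> t))"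
    using NM.Fubini_integral[OF F] by (simp add: inner outer)
  show "integrable M (\<lambda>\<omega>. Y \<omega> * (LINT t:{a..b}|N. Z \<omega> t))"
    using NM.integrable_snd[OF F] by (simp add: inner)
qed

text \<open>Pairing with a measure commutes with the expectation. With \<open>Y = Z\<^sub>s\<close> and with
  \<open>Y = \<langle>\<nu>, Z\<rangle>\<close> this expresses the covariance operator through second moments of pairings.\<close>

lemma pairing_cross_moment:
  assumes "Y \<in> borel_measurable M" "integrable M (\<lambda>\<omega>. (Y \<omega>)\<^sup>2)"
  shows "pairing {a..b} \<nu> (\<lambda>t. LINT \<omega>|M. Y \<omega> * Z \<omega> t) = (LINT \<omega>|M. Y \<omega> * pairing {a..b} \<nu> (Z \<omega>))"
  using Fubini_path[OF assms finite_measure_pos_part sets_pos_part, of \<nu>]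
    Fubini_path[OF assms finite_measure_pos_part sets_pos_part, of "- \<nu>"]
  by (simp add: pairing_def neg_part_def right_diff_distrib)

text \<open>The covariance form \<open>E (\<langle>\<mu>, Z\<rangle> \<langle>\<nu>, Z\<rangle>)\<close>; no centering is needed, as the means vanish.\<close>

definition covar :: "signed_measure \<Rightarrow> signed_measure \<Rightarrow> real" where
  "covar \<mu> \<nu> = (LINT \<omega>|M. pairing {a..b} \<mu> (Z \<omega>) * pairing {a..b} \<nu> (Z \<omega>))"

lemma cov_op_eq:
  assumes "\<mu> \<in> signed_measures_on {a..b}" "s \<in> {a..b}"
  shows "cov_op M {a..b} Z \<mu> s = (LINT \<omega>|M. pairing {a..b} \<mu> (Z \<omega>) * Z \<omega> s)"
proof -
  have "cov_op M {a..b} Z \<mu> s = pairing {a..b} \<mu> (\<lambda>t. LINT \<omega>|M. Z \<omega> s * Z \<omega> t)"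
    unfolding cov_op_def using assms(2)
    by (intro pairing_cong) (simp add: cov_fun_def covariance_def path_mean)
  then show ?thesis
    using pairing_cross_moment[OF path_measurable path_square_integrable, of s] assms(2)
    by (simp add: mult.commute)
qed

lemma bounded_borel_cov_op:
  assumes "\<mu> \<in> signed_measures_on {a..b}"
  shows "bounded_borel_on {a..b} (cov_op M {a..b} Z \<mu>)"
proof -
  have "bounded_borel_on {a..b} (\<lambda>s. LINT \<omega>|M. pairing {a..b} \<mu> (Z \<omega>) * Z \<omega> s)"
    by (rule bounded_borel_cross_moment[OF pairing_measurable[OF assms] pairing_square_integrable[OF assms]])
  then show ?thesis
    by (subst bounded_borel_on_cong[OF cov_op_eq[OF assms]])
qed

lemma pairing_cov_op:
  assumes "\<nu> \<in> signed_measures_on {a..b}"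
  shows "pairing {a..b} \<mu> (cov_op M {a..b} Z \<nu>) = covar \<mu> \<nu>"
proof -
  have "pairing {a..b} \<mu> (cov_op M {a..b} Z \<nu>)
      = pairing {a..b} \<mu> (\<lambda>s. LINT \<omega>|M. pairing {a..b} \<nu> (Z \<omega>) * Z \<omega> s)"
    using cov_op_eq[OF assms] by (rule pairing_cong)
  also have "\<dots> = covar \<mu> \<nu>"
    using pairing_cross_moment[OF pairing_measurable[OF assms] pairing_square_integrable[OF assms]]
    by (simp add: covar_def mult.commute)
  finally show ?thesis .
qed

end

section \<open>Maximizers of linearly perturbed quadratic forms\<close>

text \<open>A bounded symmetric positive semidefinite bilinear form on a subspace \<open>S\<close>; bilinearity is
  assumed in the first argument only and follows in the second by symmetry.\<close>

locale psd_form =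
  fixes S :: "'b::real_normed_vector set" and B :: "'b \<Rightarrow> 'b \<Rightarrow> real" and C :: real
  assumes subspace_S: "subspace S"
    and B_commute: "\<And>x y. x \<in> S \<Longrightarrow> y \<in> S \<Longrightarrow> B x y = B y x"
    and B_add: "\<And>x y z. x \<in> S \<Longrightarrow> y \<in> S \<Longrightarrow> z \<in> S \<Longrightarrow> B (x + y) z = B x z + B y z"
    and B_scale: "\<And>k x z. x \<in> S \<Longrightarrow> z \<in> S \<Longrightarrow> B (k *\<^sub>R x) z = k * B x z"
    and B_nonneg: "\<And>x. x \<in> S \<Longrightarrow> 0 \<le> B x x"
    and C_nonneg: "0 \<le> C"
    and B_bound: "\<And>x y. x \<in> S \<Longrightarrow> y \<in> S \<Longrightarrow> \<bar>B x y\<bar> \<le> C * norm x * norm y"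
begin

lemmas S_closed = subspace_0[OF subspace_S] subspace_add[OF subspace_S]
  subspace_scale[OF subspace_S] subspace_diff[OF subspace_S]

lemma B_add_right: "x \<in> S \<Longrightarrow> y \<in> S \<Longrightarrow> z \<in> S \<Longrightarrow> B z (x + y) = B z x + B z y"
  by (simp add: B_commute[of z] B_add S_closed)

lemma B_scale_right: "x \<in> S \<Longrightarrow> z \<in> S \<Longrightarrow> B z (k *\<^sub>R x) = k * B z x"
  by (simp add: B_commute[of z] B_scale S_closed)

lemma B_self_add:
  assumes "x \<in> S" "y \<in> S"
  shows "B (x + y) (x + y) = B x x + 2 * B x y + B y y"
  using assms by (simp add: B_add B_add_right S_closed B_commute[of y x])

lemma B_null:
  assumes xy: "x \<in> S" "y \<in> S" and 0: "B x x = 0"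
  shows "B x y = 0"
proof (rule ccontr)
  assume *: "B x y \<noteq> 0"
  \<comment> \<open>The form at \<open>t *\<^sub>R x + y\<close> is affine in \<open>t\<close>; this \<open>t\<close> gives it the value \<open>-1\<close>.\<close>
  define t where "t = - (B y y + 1) / (2 * B x y)"
  have "0 \<le> B (t *\<^sub>R x + y) (t *\<^sub>R x + y)"
    using xy by (simp add: B_nonneg S_closed)
  also have "\<dots> = 2 * t * B x y + B y y"
    using xy 0 by (simp add: B_self_add B_scale B_scale_right S_closed)
  also have "\<dots> = - 1"
    using * by (simp add: t_def field_simps)
  finally show False by simp
qed

lemma continuous_on_B_self: "continuous_on S (\<lambda>x. B x x)"
  unfolding continuous_on_def
proof
  fix x assume x: "x \<in> S"
  have "((\<lambda>y. B y y - B x x) \<longlongrightarrow> 0) (at x within S)"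
  proof (rule Lim_null_comparison)
    show "\<forall>\<^sub>F y in at x within S. norm (B y y - B x x) \<le> C * norm (y - x) * (norm (y - x) + 2 * norm x)"
      unfolding eventually_at_filter
    proof (intro always_eventually allI impI)
      fix y assume y: "y \<in> S"
      have "B (x + (y - x)) (x + (y - x)) = B x x + 2 * B x (y - x) + B (y - x) (y - x)"
        using x y by (intro B_self_add S_closed)
      moreover have "\<bar>B x (y - x)\<bar> \<le> C * norm x * norm (y - x)"
        "\<bar>B (y - x) (y - x)\<bar> \<le> C * norm (y - x) * norm (y - x)"
        using x y by (auto intro!: B_bound S_closed)
      ultimately show "norm (B y y - B x x) \<le> C * norm (y - x) * (norm (y - x) + 2 * norm x)"
        by (simp add: algebra_simps)
    qed
    have "((\<lambda>y. C * norm (y - x) * (norm (y - x) + 2 * norm x)) \<longlongrightarrow>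
        C * norm (x - x) * (norm (x - x) + 2 * norm x)) (at x within S)"
      by (intro tendsto_intros)
    then show "((\<lambda>y. C * norm (y - x) * (norm (y - x) + 2 * norm x)) \<longlongrightarrow> 0) (at x within S)"
      by simp
  qed
  then show "((\<lambda>y. B y y) \<longlongrightarrow> B x x) (at x within S)"
    by (simp add: LIM_zero_iff)
qed

end

text \<open>A map \<open>m\<close> into \<open>S\<close>, differentiable at an interior point \<open>\<theta>\<^sub>0\<close> of the compact set \<open>\<Theta>\<close>.
  The seminorm given by \<open>B\<close> separates \<open>m \<theta>\<^sub>0\<close> from the other values of \<open>m\<close>, and it is a norm on the
  tangent directions \<open>D u\<close>.\<close>

locale identifiable_model = psd_form S B C
  for S :: "'b::real_normed_vector set" and B C +
  fixes m :: "'a::euclidean_space \<Rightarrow> 'b" and D :: "'a \<Rightarrow> 'b" and \<Theta> :: "'a set" and \<theta>\<^sub>0 :: 'a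
  assumes compact_\<Theta>: "compact \<Theta>" and \<theta>\<^sub>0: "\<theta>\<^sub>0 \<in> interior \<Theta>"
    and m_in_S: "\<And>\<theta>. \<theta> \<in> \<Theta> \<Longrightarrow> m \<theta> \<in> S" and m_cont: "continuous_on \<Theta> m"
    and deriv: "(m has_derivative D) (at \<theta>\<^sub>0)" and D_in_S: "\<And>u. D u \<in> S"
    and identifiable: "\<And>\<theta>. \<theta> \<in> \<Theta> \<Longrightarrow> B (m \<theta> - m \<theta>\<^sub>0) (m \<theta> - m \<theta>\<^sub>0) = 0 \<Longrightarrow> \<theta> = \<theta>\<^sub>0"
    and D_nondegenerate: "\<And>u. B (D u) (D u) = 0 \<Longrightarrow> u = 0"
begin

lemma linear_D: "linear D" and bounded_linear_D: "bounded_linear D"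
  using deriv by (auto simp: has_derivative_linear has_derivative_bounded_linear)

lemma \<theta>\<^sub>0_in_\<Theta>: "\<theta>\<^sub>0 \<in> \<Theta>"
  using \<theta>\<^sub>0 interior_subset by auto

lemma diff_in_S: "\<theta> \<in> \<Theta> \<Longrightarrow> m \<theta> - m \<theta>\<^sub>0 \<in> S"
  by (intro S_closed m_in_S \<theta>\<^sub>0_in_\<Theta>)

lemma D_bound:
  obtains K where "0 \<le> K" "\<And>u. norm (D u) \<le> K * norm u"
  using bounded_linear.nonneg_bounded[OF bounded_linear_D] by (auto simp: mult.commute)

lemma linearization:
  assumes "0 < \<eta>"
  obtains r where "0 < r" "cball \<theta>\<^sub>0 r \<subseteq> \<Theta>"
    "\<And>\<theta>. norm (\<theta> - \<theta>\<^sub>0) \<le> r \<Longrightarrow> norm (m \<theta> - m \<theta>\<^sub>0 - D (\<theta> - \<theta>\<^sub>0)) \<le> \<eta> * norm (\<theta> - \<theta>\<^sub>0)"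
proof -
  obtain d where d: "0 < d"
    "\<And>\<theta>. norm (\<theta> - \<theta>\<^sub>0) < d \<Longrightarrow> norm (m \<theta> - m \<theta>\<^sub>0 - D (\<theta> - \<theta>\<^sub>0)) \<le> \<eta> * norm (\<theta> - \<theta>\<^sub>0)"
    using has_derivative_at_alt[THEN iffD1, OF deriv, THEN conjunct2, rule_format, OF assms] by auto
  obtain e where e: "0 < e" "cball \<theta>\<^sub>0 e \<subseteq> \<Theta>"
    using \<theta>\<^sub>0 by (auto simp: mem_interior_cball)
  show thesis
    using d e by (intro that[of "min (d / 2) e"]) auto
qed

lemma D_coercive:
  obtains c where "0 < c" "\<And>u. c * (norm u)\<^sup>2 \<le> B (D u) (D u)"
proof -
  have "continuous_on (sphere 0 1) (\<lambda>u. B (D u) (D u))"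
    using D_in_S linear_continuous_on[OF bounded_linear_D]
    by (intro continuous_on_compose2[OF continuous_on_B_self]) auto
  moreover have "sphere (0::'a) 1 \<noteq> {}" by simp
  ultimately have "\<exists>w\<in>sphere 0 1. \<forall>u\<in>sphere 0 1. B (D w) (D w) \<le> B (D u) (D u)"
    by (intro continuous_attains_inf compact_sphere)
  then obtain w where w: "norm w = 1" "\<And>u. norm u = 1 \<Longrightarrow> B (D w) (D w) \<le> B (D u) (D u)"
    by auto
  show thesis
  proof (rule that[of "B (D w) (D w)"])
    show "0 < B (D w) (D w)"
      using D_nondegenerate[of w] B_nonneg[OF D_in_S, of w] w(1) by fastforce
    fix u
    show "B (D w) (D w) * (norm u)\<^sup>2 \<le> B (D u) (D u)"
    proof (cases "u = 0")
      case False
      define v where "v = inverse (norm u) *\<^sub>R u"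
      have u: "u = norm u *\<^sub>R v" and v: "norm v = 1" using False by (simp_all add: v_def)
      have "B (D u) (D u) = (norm u)\<^sup>2 * B (D v) (D v)"
        by (subst (1 2) u) (simp add: linear_cmul[OF linear_D] B_scale B_scale_right D_in_S S_closed
            power2_eq_square)
      then show ?thesis using w(2)[OF v] by (simp add: mult.commute mult_right_mono)
    qed (simp add: linear_0[OF linear_D] B_nonneg S_closed)
  qed
qed

text \<open>Near \<open>\<theta>\<^sub>0\<close> both bounds hold by differentiability, the first with coercivity on the tangent
  directions; away from \<open>\<theta>\<^sub>0\<close> they hold by compactness, the first with identifiability.\<close>

lemma global_bounds:
  obtains \<kappa> L where "0 < \<kappa>" "0 \<le> L"
    "\<And>\<theta>. \<theta> \<in> \<Theta> \<Longrightarrow> \<kappa> * (norm (\<theta> - \<theta>\<^sub>0))\<^sup>2 \<le> B (m \<theta> - m \<theta>\<^sub>0) (m \<theta> - m \<theta>\<^sub>0)"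
    "\<And>\<theta>. \<theta> \<in> \<Theta> \<Longrightarrow> norm (m \<theta> - m \<theta>\<^sub>0) \<le> L * norm (\<theta> - \<theta>\<^sub>0)"
proof -
  obtain c where c: "0 < c" "\<And>u. c * (norm u)\<^sup>2 \<le> B (D u) (D u)" by (rule D_coercive) (rule that)
  obtain K where K: "0 \<le> K" "\<And>u. norm (D u) \<le> K * norm u" by (rule D_bound) (rule that)
  \<comment> \<open>A linearization error of \<open>\<eta>\<close> per unit length costs at most half of the coercivity constant.\<close>
  define \<eta> where "\<eta> = c / (4 * (C * K + 1))"
  have CK: "0 \<le> C * K" using C_nonneg K(1) by simp
  have \<eta>: "0 < \<eta>" "2 * (C * K) * \<eta> \<le> c / 2"
    using c(1) CK by (auto simp: \<eta>_def field_simps)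
  obtain r where r: "0 < r"
    "\<And>\<theta>. norm (\<theta> - \<theta>\<^sub>0) \<le> r \<Longrightarrow> norm (m \<theta> - m \<theta>\<^sub>0 - D (\<theta> - \<theta>\<^sub>0)) \<le> \<eta> * norm (\<theta> - \<theta>\<^sub>0)"
    using linearization[OF \<eta>(1)] by metis
  have near_Q: "c / 2 * (norm (\<theta> - \<theta>\<^sub>0))\<^sup>2 \<le> B (m \<theta> - m \<theta>\<^sub>0) (m \<theta> - m \<theta>\<^sub>0)"
    and near_L: "norm (m \<theta> - m \<theta>\<^sub>0) \<le> (K + \<eta>) * norm (\<theta> - \<theta>\<^sub>0)"
    if "\<theta> \<in> \<Theta>" "norm (\<theta> - \<theta>\<^sub>0) \<le> r" for \<theta>
  proof -
    define h where "h = \<theta> - \<theta>\<^sub>0"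
    define \<rho> where "\<rho> = m \<theta> - m \<theta>\<^sub>0 - D h"
    have eq: "m \<theta> - m \<theta>\<^sub>0 = D h + \<rho>" by (simp add: \<rho>_def)
    have \<rho>: "\<rho> \<in> S" "norm \<rho> \<le> \<eta> * norm h"
      using that r(2) by (auto simp: \<rho>_def h_def intro!: S_closed(4) diff_in_S D_in_S)
    have "\<bar>B (D h) \<rho>\<bar> \<le> C * norm (D h) * norm \<rho>"
      by (intro B_bound D_in_S \<rho>)
    also have "\<dots> \<le> C * (K * norm h) * (\<eta> * norm h)"
      using C_nonneg K \<rho> by (intro mult_mono) auto
    also have "\<dots> = (C * K * \<eta>) * (norm h)\<^sup>2" by (simp add: power2_eq_square)
    finally have "2 * \<bar>B (D h) \<rho>\<bar> \<le> 2 * (C * K) * \<eta> * (norm h)\<^sup>2" by simp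
    also have "\<dots> \<le> c / 2 * (norm h)\<^sup>2"
      using \<eta>(2) by (rule mult_right_mono) simp
    finally show "c / 2 * (norm (\<theta> - \<theta>\<^sub>0))\<^sup>2 \<le> B (m \<theta> - m \<theta>\<^sub>0) (m \<theta> - m \<theta>\<^sub>0)"
      using c(2)[of h] B_nonneg[OF \<rho>(1)] unfolding eq B_self_add[OF D_in_S \<rho>(1)] h_def[symmetric]
      by linarith
    show "norm (m \<theta> - m \<theta>\<^sub>0) \<le> (K + \<eta>) * norm (\<theta> - \<theta>\<^sub>0)"
      unfolding eq h_def[symmetric] using norm_triangle_ineq[of "D h" \<rho>] K(2)[of h] \<rho>(2)
      by (simp add: distrib_right)
  qed
  \<comment> \<open>Away from \<open>\<theta>\<^sub>0\<close>: the form has a positive lower bound on the compact set \<open>F\<close>.\<close>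
  define F where "F = \<Theta> - ball \<theta>\<^sub>0 r"
  have F: "compact F" using compact_\<Theta> by (auto simp: F_def intro: compact_diff)
  have Fr: "\<theta> \<in> F" "r \<le> norm (\<theta> - \<theta>\<^sub>0)" if "\<theta> \<in> \<Theta>" "\<not> norm (\<theta> - \<theta>\<^sub>0) \<le> r" for \<theta>
    using that by (auto simp: F_def dist_norm norm_minus_commute)
  have contd: "continuous_on F (\<lambda>\<theta>. m \<theta> - m \<theta>\<^sub>0)"
    using m_cont by (intro continuous_intros) (auto simp: F_def intro: continuous_on_subset)
  have "continuous_on F (\<lambda>\<theta>. B (m \<theta> - m \<theta>\<^sub>0) (m \<theta> - m \<theta>\<^sub>0))"
    using contd diff_in_S by (intro continuous_on_compose2[OF continuous_on_B_self]) (auto simp: F_def)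
  then have "\<exists>q>0. \<forall>\<theta>\<in>F. q \<le> B (m \<theta> - m \<theta>\<^sub>0) (m \<theta> - m \<theta>\<^sub>0)"
  proof (cases "F = {}")
    case False
    assume "continuous_on F (\<lambda>\<theta>. B (m \<theta> - m \<theta>\<^sub>0) (m \<theta> - m \<theta>\<^sub>0))"
    then obtain w where w: "w \<in> F"
      "\<And>\<theta>. \<theta> \<in> F \<Longrightarrow> B (m w - m \<theta>\<^sub>0) (m w - m \<theta>\<^sub>0) \<le> B (m \<theta> - m \<theta>\<^sub>0) (m \<theta> - m \<theta>\<^sub>0)"
      using continuous_attains_inf[OF F False] by blast
    have "w \<in> \<Theta>" "w \<noteq> \<theta>\<^sub>0" using w(1) r(1) by (auto simp: F_def)
    then have "0 < B (m w - m \<theta>\<^sub>0) (m w - m \<theta>\<^sub>0)"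
      using identifiable[of w] B_nonneg[OF diff_in_S, of w] by force
    with w(2) show ?thesis by blast
  qed (auto intro: exI[of _ 1])
  then obtain q where q: "0 < q" "\<And>\<theta>. \<theta> \<in> F \<Longrightarrow> q \<le> B (m \<theta> - m \<theta>\<^sub>0) (m \<theta> - m \<theta>\<^sub>0)" by blast
  obtain G where G: "0 < G" "\<And>\<theta>. \<theta> \<in> F \<Longrightarrow> norm (m \<theta> - m \<theta>\<^sub>0) \<le> G"
    using compact_imp_bounded[OF compact_continuous_image[OF contd F]] by (auto simp: bounded_pos)
  obtain E where E: "0 < E" "\<And>\<theta>. \<theta> \<in> \<Theta> \<Longrightarrow> norm (\<theta> - \<theta>\<^sub>0) \<le> E"
    using bounded_translation[OF compact_imp_bounded[OF compact_\<Theta>], of "- \<theta>\<^sub>0"]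
    by (auto simp: bounded_pos)
  show thesis
  proof (rule that[of "min (c / 2) (q / E\<^sup>2)" "max (K + \<eta>) (G / r)"])
    show "0 < min (c / 2) (q / E\<^sup>2)" "0 \<le> max (K + \<eta>) (G / r)"
      using c q E K \<eta> by auto
    fix \<theta> assume \<theta>: "\<theta> \<in> \<Theta>"
    show "min (c / 2) (q / E\<^sup>2) * (norm (\<theta> - \<theta>\<^sub>0))\<^sup>2 \<le> B (m \<theta> - m \<theta>\<^sub>0) (m \<theta> - m \<theta>\<^sub>0)"
    proof (cases "norm (\<theta> - \<theta>\<^sub>0) \<le> r")
      case True
      have "min (c / 2) (q / E\<^sup>2) * (norm (\<theta> - \<theta>\<^sub>0))\<^sup>2 \<le> c / 2 * (norm (\<theta> - \<theta>\<^sub>0))\<^sup>2"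
        by (rule mult_right_mono[OF min.cobounded1]) simp
      with near_Q[OF \<theta> True] show ?thesis by linarith
    next
      case False
      have "min (c / 2) (q / E\<^sup>2) * (norm (\<theta> - \<theta>\<^sub>0))\<^sup>2 \<le> q / E\<^sup>2 * E\<^sup>2"
        using q(1) E \<theta> by (intro mult_mono power_mono) auto
      also have "\<dots> = q" using E(1) by simp
      finally show ?thesis using q(2)[OF Fr(1)[OF \<theta> False]] by linarith
    qed
    show "norm (m \<theta> - m \<theta>\<^sub>0) \<le> max (K + \<eta>) (G / r) * norm (\<theta> - \<theta>\<^sub>0)"
    proof (cases "norm (\<theta> - \<theta>\<^sub>0) \<le> r")
      case True
      have "(K + \<eta>) * norm (\<theta> - \<theta>\<^sub>0) \<le> max (K + \<eta>) (G / r) * norm (\<theta> - \<theta>\<^sub>0)"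
        by (intro mult_right_mono) auto
      with near_L[OF \<theta> True] show ?thesis by linarith
    next
      case False
      have "G = G / r * r" using r(1) by simp
      also have "\<dots> \<le> max (K + \<eta>) (G / r) * norm (\<theta> - \<theta>\<^sub>0)"
        using Fr(2)[OF \<theta> False] G(1) r(1) by (intro mult_mono) (auto simp: le_max_iff_disj)
      finally show ?thesis using G(2)[OF Fr(1)[OF \<theta> False]] by linarith
    qed
  qed
qed

text \<open>The deterministic core. Let \<open>\<theta>\<close> maximize
  \<open>\<epsilon> * l (m \<theta> - m \<theta>\<^sub>0) - B (m \<theta> - m \<theta>\<^sub>0) (m \<theta> - m \<theta>\<^sub>0) / 2\<close> for a linear functional \<open>l\<close> of norm at most
  \<open>R\<close> on \<open>S\<close>. After rescaling by \<open>\<epsilon>\<close> the objective is close to \<open>l (D u) - B (D u) (D u) / 2\<close>, whose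
  unique maximizer is the \<open>v\<close> that represents \<open>l\<close> on the tangent directions. The bound on \<open>\<epsilon>\<close>
  depends on \<open>l\<close> only through \<open>R\<close>, which is what turns the statement into one about convergence in
  probability.\<close>

lemma argmax_asymptotics:
  assumes R: "0 \<le> R" and \<delta>: "0 < \<delta>"
  obtains \<epsilon>\<^sub>0 where "0 < \<epsilon>\<^sub>0"
    "\<And>\<epsilon> l \<theta> v. \<lbrakk>0 < \<epsilon>; \<epsilon> < \<epsilon>\<^sub>0; linear l; \<And>x. x \<in> S \<Longrightarrow> \<bar>l x\<bar> \<le> R * norm x;
       \<And>u. l (D u) = B (D v) (D u); \<theta> \<in> \<Theta>;
       \<And>\<theta>'. \<theta>' \<in> \<Theta> \<Longrightarrow> \<epsilon> * l (m \<theta>' - m \<theta>\<^sub>0) - B (m \<theta>' - m \<theta>\<^sub>0) (m \<theta>' - m \<theta>\<^sub>0) / 2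
         \<le> \<epsilon> * l (m \<theta> - m \<theta>\<^sub>0) - B (m \<theta> - m \<theta>\<^sub>0) (m \<theta> - m \<theta>\<^sub>0) / 2\<rbrakk>
      \<Longrightarrow> norm (inverse \<epsilon> *\<^sub>R (\<theta> - \<theta>\<^sub>0) - v) \<le> \<delta>"
proof -
  obtain c where c: "0 < c" "\<And>u. c * (norm u)\<^sup>2 \<le> B (D u) (D u)" by (rule D_coercive) (rule that)
  obtain K where K: "0 \<le> K" "\<And>u. norm (D u) \<le> K * norm u" by (rule D_bound) (rule that)
  obtain \<kappa> L where \<kappa>: "0 < \<kappa>" "0 \<le> L"
    "\<And>\<theta>. \<theta> \<in> \<Theta> \<Longrightarrow> \<kappa> * (norm (\<theta> - \<theta>\<^sub>0))\<^sup>2 \<le> B (m \<theta> - m \<theta>\<^sub>0) (m \<theta> - m \<theta>\<^sub>0)"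
    "\<And>\<theta>. \<theta> \<in> \<Theta> \<Longrightarrow> norm (m \<theta> - m \<theta>\<^sub>0) \<le> L * norm (\<theta> - \<theta>\<^sub>0)"
    by (rule global_bounds) (rule that)
  \<comment> \<open>\<open>U\<close> bounds both the rescaled maximizer and \<open>v\<close>; \<open>\<eta> * A\<close> bounds the error of the quadratic
    approximation on the ball of radius \<open>U\<close>.\<close>
  define U where "U = max 1 (max (2 * R * L / \<kappa>) (R * K / c))"
  have U: "0 < U" by (simp add: U_def)
  define A where "A = C * K * U\<^sup>2 + C * U\<^sup>2 + R * U"
  have A: "0 \<le> A" using C_nonneg K R U by (simp add: A_def)
  define \<eta> where "\<eta> = min 1 (c * \<delta>\<^sup>2 / (4 * (A + 1)))"
  have \<eta>: "0 < \<eta>" "\<eta> \<le> 1" using c \<delta> A by (auto simp: \<eta>_def)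
  have "\<eta> * (4 * (A + 1)) \<le> c * \<delta>\<^sup>2 / (4 * (A + 1)) * (4 * (A + 1))"
    using A by (intro mult_right_mono) (auto simp: \<eta>_def)
  also have "\<dots> = c * \<delta>\<^sup>2" using A by simp
  finally have \<eta>A: "4 * (\<eta> * A) \<le> c * \<delta>\<^sup>2"
    using \<eta>(1) by (simp add: distrib_left)
  obtain r where r: "0 < r" "cball \<theta>\<^sub>0 r \<subseteq> \<Theta>"
    "\<And>\<theta>. norm (\<theta> - \<theta>\<^sub>0) \<le> r \<Longrightarrow> norm (m \<theta> - m \<theta>\<^sub>0 - D (\<theta> - \<theta>\<^sub>0)) \<le> \<eta> * norm (\<theta> - \<theta>\<^sub>0)"
    using linearization[OF \<eta>(1)] by metis
  show thesis
  proof (rule that[of "r / U"])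
    show "0 < r / U" using r U by simp
    fix \<epsilon> l \<theta> v
    assume \<epsilon>: "0 < \<epsilon>" "\<epsilon> < r / U" and l: "linear l" and lR: "\<And>x. x \<in> S \<Longrightarrow> \<bar>l x\<bar> \<le> R * norm x"
      and lD: "\<And>u. l (D u) = B (D v) (D u)" and \<theta>: "\<theta> \<in> \<Theta>"
      and max: "\<And>\<theta>'. \<theta>' \<in> \<Theta> \<Longrightarrow> \<epsilon> * l (m \<theta>' - m \<theta>\<^sub>0) - B (m \<theta>' - m \<theta>\<^sub>0) (m \<theta>' - m \<theta>\<^sub>0) / 2
         \<le> \<epsilon> * l (m \<theta> - m \<theta>\<^sub>0) - B (m \<theta> - m \<theta>\<^sub>0) (m \<theta> - m \<theta>\<^sub>0) / 2"
    have \<epsilon>U: "\<epsilon> * U \<le> r" using \<epsilon>(2) U by (simp add: field_simps)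
    define u where "u = inverse \<epsilon> *\<^sub>R (\<theta> - \<theta>\<^sub>0)"
    have \<theta>_eq: "\<theta> = \<theta>\<^sub>0 + \<epsilon> *\<^sub>R u" using \<epsilon>(1) by (simp add: u_def)
    have dist: "norm (\<theta> - \<theta>\<^sub>0) = \<epsilon> * norm u" using \<epsilon>(1) by (simp add: \<theta>_eq)
    have cancel: "x \<le> y" if "0 < z" "z * x\<^sup>2 \<le> z * y * x" "0 \<le> y" for x y z :: real
    proof (cases "x \<le> 0")
      case False
      then have "0 < z * x" "(z * x) * x \<le> (z * x) * y"
        using that by (simp_all add: power2_eq_square mult.assoc mult.commute[of x y])
      then show ?thesis by (rule mult_left_le_imp_le[rotated])
    qed (use that in linarith)
    have B_0: "B 0 0 = 0"
      using B_scale[OF S_closed(1) S_closed(1), of 0] by simp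
    \<comment> \<open>The maximizer is at distance of order \<open>\<epsilon>\<close> from \<open>\<theta>\<^sub>0\<close>, by comparison with \<open>\<theta>\<^sub>0\<close>.\<close>
    have uU: "norm u \<le> U"
    proof -
      have "0 \<le> \<epsilon> * l (m \<theta> - m \<theta>\<^sub>0) - B (m \<theta> - m \<theta>\<^sub>0) (m \<theta> - m \<theta>\<^sub>0) / 2"
        using max[OF \<theta>\<^sub>0_in_\<Theta>] unfolding diff_self linear_0[OF l] B_0 by simp
      then have "\<kappa> * (norm (\<theta> - \<theta>\<^sub>0))\<^sup>2 \<le> 2 * (\<epsilon> * l (m \<theta> - m \<theta>\<^sub>0))"
        using \<kappa>(3)[OF \<theta>] by linarith
      also have "\<dots> \<le> 2 * (\<epsilon> * (R * (L * norm (\<theta> - \<theta>\<^sub>0))))"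
      proof -
        have "l (m \<theta> - m \<theta>\<^sub>0) \<le> R * (L * norm (\<theta> - \<theta>\<^sub>0))"
          using lR[OF diff_in_S[OF \<theta>]] mult_left_mono[OF \<kappa>(4)[OF \<theta>] R] by linarith
        then show ?thesis using \<epsilon>(1) by simp
      qed
      also have "\<dots> = (\<kappa> * \<epsilon>\<^sup>2) * (2 * R * L / \<kappa>) * norm u"
        using \<kappa>(1) by (simp add: dist power2_eq_square)
      finally have "(\<kappa> * \<epsilon>\<^sup>2) * (norm u)\<^sup>2 \<le> (\<kappa> * \<epsilon>\<^sup>2) * (2 * R * L / \<kappa>) * norm u"
        by (simp add: dist power_mult_distrib)
      then have "norm u \<le> 2 * R * L / \<kappa>"
        by (rule cancel[rotated]) (use \<kappa>(1,2) R \<epsilon>(1) in auto)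
      then show ?thesis by (simp add: U_def)
    qed
    \<comment> \<open>Coercivity on the tangent directions bounds the representer of \<open>l\<close>.\<close>
    have vU: "norm v \<le> U"
    proof -
      have "c * (norm v)\<^sup>2 \<le> l (D v)" using c(2)[of v] lD[of v] by simp
      also have "\<dots> \<le> R * (K * norm v)"
        using lR[OF D_in_S, of v] mult_left_mono[OF K(2) R, of v] by linarith
      also have "\<dots> = c * (R * K / c) * norm v" using c(1) by simp
      finally have "norm v \<le> R * K / c"
        by (rule cancel[rotated]) (use c(1) R K(1) in auto)
      then show ?thesis by (simp add: U_def)
    qed
    define q where "q w = l (D w) - B (D w) (D w) / 2" for w
    have approx: "\<bar>(\<epsilon> * l (m (\<theta>\<^sub>0 + \<epsilon> *\<^sub>R w) - m \<theta>\<^sub>0)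
          - B (m (\<theta>\<^sub>0 + \<epsilon> *\<^sub>R w) - m \<theta>\<^sub>0) (m (\<theta>\<^sub>0 + \<epsilon> *\<^sub>R w) - m \<theta>\<^sub>0) / 2) - \<epsilon>\<^sup>2 * q w\<bar> \<le> \<epsilon>\<^sup>2 * (\<eta> * A)"
      and in_\<Theta>: "\<theta>\<^sub>0 + \<epsilon> *\<^sub>R w \<in> \<Theta>" if w: "norm w \<le> U" for w
    proof -
      have "\<epsilon> * norm w \<le> r" using mult_left_mono[OF w, of \<epsilon>] \<epsilon>(1) \<epsilon>U by linarith
      then have small: "norm (\<theta>\<^sub>0 + \<epsilon> *\<^sub>R w - \<theta>\<^sub>0) \<le> r" using \<epsilon>(1) by simp
      then show in\<Theta>: "\<theta>\<^sub>0 + \<epsilon> *\<^sub>R w \<in> \<Theta>"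
        using r(2) by (auto simp: dist_norm subset_iff norm_minus_commute)
      define d where "d = m (\<theta>\<^sub>0 + \<epsilon> *\<^sub>R w) - m \<theta>\<^sub>0"
      \<comment> \<open>\<open>d = \<epsilon> (D w + \<rho>)\<close>, where the rescaled linearization error \<open>\<rho>\<close> is at most \<open>\<eta> * U\<close>.\<close>
      define \<rho> where "\<rho> = inverse \<epsilon> *\<^sub>R (d - D (\<epsilon> *\<^sub>R w))"
      have d_eq: "d = \<epsilon> *\<^sub>R (D w + \<rho>)"
        using \<epsilon>(1) by (simp add: \<rho>_def linear_cmul[OF linear_D] scaleR_add_right)
      have \<rho>S: "\<rho> \<in> S"
        unfolding \<rho>_def d_def by (intro S_closed(3,4) m_in_S in\<Theta> \<theta>\<^sub>0_in_\<Theta> D_in_S)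
      have "norm (d - D (\<epsilon> *\<^sub>R w)) \<le> \<eta> * (\<epsilon> * norm w)"
        using r(3)[OF small] \<epsilon>(1) by (simp add: d_def)
      also have "\<dots> \<le> \<epsilon> * (\<eta> * U)"
        using w \<eta> \<epsilon> by (simp add: mult.left_commute)
      finally have "norm (d - D (\<epsilon> *\<^sub>R w)) / \<epsilon> \<le> \<eta> * U"
        using \<epsilon>(1) by (simp only: pos_divide_le_eq mult.commute[of _ \<epsilon>])
      moreover have "norm \<rho> = norm (d - D (\<epsilon> *\<^sub>R w)) / \<epsilon>"
        using \<epsilon>(1) by (simp only: \<rho>_def norm_scaleR) (simp add: divide_inverse)
      ultimately have \<rho>: "norm \<rho> \<le> \<eta> * U" by simp
      have Dw: "norm (D w) \<le> K * U"
        using K(2)[of w] mult_left_mono[OF w K(1)] by linarith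
      have Dl: "\<epsilon> * l d = \<epsilon>\<^sup>2 * (l (D w) + l \<rho>)"
        by (simp add: d_eq linear_cmul[OF l] linear_add[OF l] power2_eq_square)
      have S1: "D w + \<rho> \<in> S" by (intro S_closed(2) D_in_S \<rho>S)
      have "B d d = \<epsilon>\<^sup>2 * B (D w + \<rho>) (D w + \<rho>)"
        unfolding d_eq using S1
        by (simp add: B_scale B_scale_right S_closed(3) power2_eq_square)
      also have "\<dots> = \<epsilon>\<^sup>2 * (B (D w) (D w) + 2 * B (D w) \<rho> + B \<rho> \<rho>)"
        by (simp add: B_self_add D_in_S \<rho>S)
      finally have eq: "(\<epsilon> * l d - B d d / 2) - \<epsilon>\<^sup>2 * q w = \<epsilon>\<^sup>2 * (l \<rho> - B (D w) \<rho> - B \<rho> \<rho> / 2)"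
        unfolding Dl q_def by (simp add: algebra_simps)
      have "\<bar>l \<rho>\<bar> \<le> R * (\<eta> * U)"
        using lR[OF \<rho>S] mult_left_mono[OF \<rho> R] by linarith
      moreover have "\<bar>B (D w) \<rho>\<bar> \<le> C * (K * U) * (\<eta> * U)"
        using C_nonneg K(1) U Dw \<rho>
        by (intro order_trans[OF B_bound[OF D_in_S \<rho>S]] mult_mono) auto
      moreover have "\<bar>B \<rho> \<rho>\<bar> \<le> C * (1 * U) * (\<eta> * U)"
        using C_nonneg U \<rho> \<eta> order_trans[OF \<rho> mult_right_mono[OF \<eta>(2)]]
        by (intro order_trans[OF B_bound[OF \<rho>S \<rho>S]] mult_mono) auto
      moreover have "R * (\<eta> * U) + C * (K * U) * (\<eta> * U) + C * (1 * U) * (\<eta> * U) = \<eta> * A"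
        by (simp add: A_def algebra_simps power2_eq_square)
      ultimately have "\<bar>l \<rho> - B (D w) \<rho> - B \<rho> \<rho> / 2\<bar> \<le> \<eta> * A" by linarith
      then have "\<bar>(\<epsilon> * l d - B d d / 2) - \<epsilon>\<^sup>2 * q w\<bar> \<le> \<epsilon>\<^sup>2 * (\<eta> * A)"
        unfolding eq by (simp add: abs_mult mult_left_mono)
      then show "\<bar>(\<epsilon> * l (m (\<theta>\<^sub>0 + \<epsilon> *\<^sub>R w) - m \<theta>\<^sub>0)
          - B (m (\<theta>\<^sub>0 + \<epsilon> *\<^sub>R w) - m \<theta>\<^sub>0) (m (\<theta>\<^sub>0 + \<epsilon> *\<^sub>R w) - m \<theta>\<^sub>0) / 2) - \<epsilon>\<^sup>2 * q w\<bar> \<le> \<epsilon>\<^sup>2 * (\<eta> * A)"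
        by (simp add: d_def)
    qed
    have "\<epsilon>\<^sup>2 * q v - \<epsilon>\<^sup>2 * (\<eta> * A) \<le> \<epsilon>\<^sup>2 * q u + \<epsilon>\<^sup>2 * (\<eta> * A)"
      using approx[OF uU] approx[OF vU] max[OF in_\<Theta>[OF vU]] unfolding \<theta>_eq by linarith
    then have "\<epsilon>\<^sup>2 * (q v - q u) \<le> \<epsilon>\<^sup>2 * (2 * (\<eta> * A))" by (simp add: algebra_simps)
    then have "q v - q u \<le> 2 * (\<eta> * A)" using \<epsilon>(1) by simp
    \<comment> \<open>\<open>v\<close> maximizes the limit objective \<open>q\<close>, with quadratic growth.\<close>
    moreover have "q v - q u = B (D (u - v)) (D (u - v)) / 2"
    proof -
      have "B (D v + D (u - v)) (D v + D (u - v)) = B (D v) (D v) + 2 * B (D v) (D (u - v)) + B (D (u - v)) (D (u - v))"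
        by (intro B_self_add D_in_S)
      moreover have "D v + D (u - v) = D u" by (simp add: linear_diff[OF linear_D])
      moreover have "B (D v) (D (u - v)) = l (D u) - l (D v)"
        unfolding lD[symmetric] by (simp add: linear_diff[OF linear_D] linear_diff[OF l])
      ultimately show ?thesis using lD[of v] by (simp add: q_def field_simps)
    qed
    ultimately have "c * (norm (u - v))\<^sup>2 \<le> c * \<delta>\<^sup>2"
      using c(2)[of "u - v"] \<eta>A by linarith
    then have "norm (u - v) \<le> \<delta>"
      using c(1) \<delta> by (simp add: power2_le_iff_abs_le)
    then show "norm (inverse \<epsilon> *\<^sub>R (\<theta> - \<theta>\<^sub>0) - v) \<le> \<delta>" by (simp add: u_def)
  qed
qed

end

section \<open>The covariance form and the contrast\<close>

lemma matrix_inv_cancel: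
  fixes A :: "real ^ 'n ^ 'n"
  assumes "invertible A"
  shows "A ** matrix_inv A = mat 1" "matrix_inv A ** A = mat 1"
  using someI_ex[OF assms[unfolded invertible_def]] by (auto simp: matrix_inv_def)

lemma transpose_matrix_inv_symmetric:
  fixes A :: "real ^ 'n ^ 'n"
  assumes "invertible A" "transpose A = A"
  shows "transpose (matrix_inv A) = matrix_inv A"
proof -
  have "transpose (matrix_inv A) ** A = mat 1"
    using arg_cong[OF matrix_inv_cancel(1)[OF assms(1)], of transpose] assms(2)
    by (simp add: matrix_transpose_mul transpose_mat)
  then have "transpose (matrix_inv A) ** (A ** matrix_inv A) = matrix_inv A"
    by (simp add: matrix_mul_assoc)
  then show ?thesis
    by (simp add: matrix_inv_cancel(1)[OF assms(1)])
qed

lemma inner_symmetric_matrix: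
  fixes A :: "real ^ 'n ^ 'n"
  assumes "transpose A = A"
  shows "x \<bullet> (A *v y) = (A *v x) \<bullet> y"
  using dot_lmul_matrix[of x A y] assms transpose_matrix_vector[of A x] by simp

lemma linear_eq_sum_axis:
  fixes f :: "real ^ 'p \<Rightarrow> 'b::real_vector"
  assumes "linear f"
  shows "f u = (\<Sum>i\<in>UNIV. (u $ i) *\<^sub>R f (axis i 1))"
proof -
  have "f u = f (\<Sum>i\<in>UNIV. (u $ i) *\<^sub>R axis i 1)"
    using basis_expansion[of u] by (simp add: scalar_mult_eq_scaleR)
  then show ?thesis
    by (simp add: linear_sum[OF assms] linear_cmul[OF assms])
qed

lemma partial_deriv_eq:
  assumes "(f has_derivative D) (at \<theta>)"
  shows "partial_deriv i f \<theta> = D (axis i 1)"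
proof -
  have "((\<lambda>t. \<theta> + t *\<^sub>R axis i (1::real)) has_derivative (\<lambda>t. t *\<^sub>R axis i 1)) (at 0)"
    by (auto intro!: derivative_eq_intros)
  then have "((\<lambda>t. f (\<theta> + t *\<^sub>R axis i 1)) has_derivative (\<lambda>t. D (t *\<^sub>R axis i 1))) (at 0)"
    by (rule has_derivative_compose) (use assms in simp)
  then have "((\<lambda>t. f (\<theta> + t *\<^sub>R axis i 1)) has_vector_derivative D (axis i 1)) (at 0)"
    by (simp add: has_vector_derivative_def linear_cmul[OF has_derivative_linear[OF assms]])
  then show ?thesis
    by (simp add: partial_deriv_def vector_derivative_at)
qed

text \<open>Vanishing off \<open>T\<close> is expressed by bounded linear functionals, so it is inherited by derivatives.\<close>

lemma derivative_in_signed_measures_on: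
  fixes \<mu> :: "'a::real_normed_vector \<Rightarrow> signed_measure"
  assumes D: "(\<mu> has_derivative D) (at \<theta>\<^sub>0)" and \<theta>\<^sub>0: "\<theta>\<^sub>0 \<in> interior \<Theta>"
    and \<mu>: "\<And>\<theta>. \<theta> \<in> \<Theta> \<Longrightarrow> \<mu> \<theta> \<in> signed_measures_on T"
  shows "D u \<in> signed_measures_on T"
  unfolding signed_measures_on_def
proof (intro CollectI ballI impI)
  fix A :: "real set" assume A: "A \<in> sets borel" "A \<inter> T = {}"
  have "((\<lambda>\<theta>. smeasure (\<mu> \<theta>) A) has_derivative (\<lambda>u. smeasure (D u) A)) (at \<theta>\<^sub>0)"
    by (rule bounded_linear.has_derivative[OF bounded_linear_smeasure D])
  moreover have "((\<lambda>\<theta>. smeasure (\<mu> \<theta>) A) has_derivative (\<lambda>u. 0)) (at \<theta>\<^sub>0)"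
  proof (rule has_derivative_transform_within_open[OF has_derivative_const open_interior \<theta>\<^sub>0])
    fix \<theta> assume "\<theta> \<in> interior \<Theta>"
    then have "\<mu> \<theta> \<in> signed_measures_on T" using \<mu> interior_subset by blast
    then show "0 = smeasure (\<mu> \<theta>) A" using A by (simp add: signed_measures_on_def)
  qed
  ultimately have "(\<lambda>u. smeasure (D u) A) = (\<lambda>u. 0)" by (rule has_derivative_unique)
  then show "smeasure (D u) A = 0" by (rule fun_cong)
qed

context gaussian_path
begin

lemma linear_pairing_path: "\<omega> \<in> space M \<Longrightarrow> linear (\<lambda>\<nu>. pairing {a..b} \<nu> (Z \<omega>))"
  by (intro linear_pairing bounded_borel_path) auto

lemma psd_form_covar:
  obtains C where "psd_form (signed_measures_on {a..b}) covar C"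
proof -
  obtain C where C: "0 \<le> C"
    "\<And>\<nu>. \<nu> \<in> signed_measures_on {a..b} \<Longrightarrow> (LINT \<omega>|M. (pairing {a..b} \<nu> (Z \<omega>))\<^sup>2) \<le> C * (norm \<nu>)\<^sup>2"
    by (rule variance_bound) (rule that)
  note int = square_integrable_mult(1)[OF pairing_measurable pairing_measurable
      pairing_square_integrable pairing_square_integrable]
  have "psd_form (signed_measures_on {a..b}) covar C"
  proof
    show "subspace (signed_measures_on {a..b})" by (rule subspace_signed_measures_on)
    show "0 \<le> C" by (rule C)
    fix x y assume x: "x \<in> signed_measures_on {a..b}" and y: "y \<in> signed_measures_on {a..b}"
    show "covar x y = covar y x" by (simp add: covar_def mult.commute)
    show "covar (x + y) z = covar x z + covar y z" if z: "z \<in> signed_measures_on {a..b}" for z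
    proof -
      have "covar (x + y) z = (LINT \<omega>|M. pairing {a..b} x (Z \<omega>) * pairing {a..b} z (Z \<omega>)
          + pairing {a..b} y (Z \<omega>) * pairing {a..b} z (Z \<omega>))"
        unfolding covar_def
        by (rule Bochner_Integration.integral_cong) (simp_all add: linear_add[OF linear_pairing_path] distrib_right)
      then show ?thesis
        by (simp add: covar_def int x y z)
    qed
    show "0 \<le> covar x x" by (simp add: covar_def)
    show "\<bar>covar x y\<bar> \<le> C * norm x * norm y"
    proof (cases "norm x * norm y = 0")
      case True
      have "pairing {a..b} 0 (Z \<omega>) = 0" if "\<omega> \<in> space M" for \<omega>
        by (rule linear_0[OF linear_pairing_path[OF that]])
      then have "pairing {a..b} x (Z \<omega>) * pairing {a..b} y (Z \<omega>) = 0" if "\<omega> \<in> space M" for \<omega>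
        using True that by auto
      then have "covar x y = (LINT \<omega>|M. 0)"
        unfolding covar_def by (rule Bochner_Integration.integral_cong[OF refl])
      then show ?thesis using C(1) by simp
    next
      case False
      \<comment> \<open>The inequality \<open>2 E |X Y| \<le> E X\<^sup>2 + E Y\<^sup>2\<close> for the pairings with \<open>x\<close> and \<open>y\<close>, scaled to the
        common norm \<open>s * t\<close>.\<close>
      define s t where "s = norm x" and "t = norm y"
      have st: "0 < s" "0 < t" using False by (auto simp: s_def t_def)
      note [measurable] = pairing_measurable[OF x] pairing_measurable[OF y]
      have "2 * (LINT \<omega>|M. \<bar>(t * pairing {a..b} x (Z \<omega>)) * (s * pairing {a..b} y (Z \<omega>))\<bar>)
          \<le> (LINT \<omega>|M. (t * pairing {a..b} x (Z \<omega>))\<^sup>2) + (LINT \<omega>|M. (s * pairing {a..b} y (Z \<omega>))\<^sup>2)"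
        using pairing_square_integrable[OF x] pairing_square_integrable[OF y]
        by (intro square_integrable_mult(2)) (auto simp: power_mult_distrib)
      also have "\<dots> = t\<^sup>2 * (LINT \<omega>|M. (pairing {a..b} x (Z \<omega>))\<^sup>2) + s\<^sup>2 * (LINT \<omega>|M. (pairing {a..b} y (Z \<omega>))\<^sup>2)"
        by (simp add: power_mult_distrib)
      also have "\<dots> \<le> t\<^sup>2 * (C * s\<^sup>2) + s\<^sup>2 * (C * t\<^sup>2)"
        using C(2)[OF x] C(2)[OF y] by (intro add_mono mult_left_mono) (auto simp: s_def t_def)
      finally have "2 * (LINT \<omega>|M. (s * t) * \<bar>pairing {a..b} x (Z \<omega>) * pairing {a..b} y (Z \<omega>)\<bar>)
          \<le> 2 * ((s * t) * (C * s * t))"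
        using st by (simp add: abs_mult power2_eq_square mult_ac)
      then have "(s * t) * (LINT \<omega>|M. \<bar>pairing {a..b} x (Z \<omega>) * pairing {a..b} y (Z \<omega>)\<bar>) \<le> (s * t) * (C * s * t)"
        by simp
      then have "(LINT \<omega>|M. \<bar>pairing {a..b} x (Z \<omega>) * pairing {a..b} y (Z \<omega>)\<bar>) \<le> C * s * t"
        using st by (simp only: mult_le_cancel_left_pos mult_pos_pos)
      moreover have "\<bar>covar x y\<bar> \<le> (LINT \<omega>|M. \<bar>pairing {a..b} x (Z \<omega>) * pairing {a..b} y (Z \<omega>)\<bar>)"
        unfolding covar_def by (rule integral_abs_bound)
      ultimately show ?thesis unfolding s_def t_def by (rule order_trans[rotated])
    qed
  next
    fix k x z assume x: "x \<in> signed_measures_on {a..b}" and z: "z \<in> signed_measures_on {a..b}"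
    have "covar (k *\<^sub>R x) z = (LINT \<omega>|M. k * (pairing {a..b} x (Z \<omega>) * pairing {a..b} z (Z \<omega>)))"
      unfolding covar_def
      by (rule Bochner_Integration.integral_cong) (simp_all add: linear_cmul[OF linear_pairing_path])
    then show "covar (k *\<^sub>R x) z = k * covar x z"
      by (simp add: covar_def)
  qed
  then show thesis by (rule that)
qed

lemma cov_op_eq_covar_dirac:
  assumes "\<mu> \<in> signed_measures_on {a..b}" "s \<in> {a..b}"
  shows "cov_op M {a..b} Z \<mu> s = covar \<mu> (dirac s)"
proof -
  have "pairing {a..b} (dirac s) (Z \<omega>) = Z \<omega> s" if "\<omega> \<in> space M" for \<omega>
    using bounded_borel_path[OF that] assms by (intro pairing_dirac) (auto simp: bounded_borel_on_def)
  then show ?thesis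
    unfolding covar_def cov_op_eq[OF assms] by (intro Bochner_Integration.integral_cong) auto
qed

text \<open>If \<open>\<langle>\<mu> - \<nu>, Z\<rangle>\<close> has variance zero, it is uncorrelated with every \<open>Z\<^sub>s\<close>. This turns
  identifiability through the covariance operator into definiteness of the covariance form.\<close>

lemma cov_op_eq_if_covar_null:
  assumes \<mu>: "\<mu> \<in> signed_measures_on {a..b}" and \<nu>: "\<nu> \<in> signed_measures_on {a..b}"
    and null: "covar (\<mu> - \<nu>) (\<mu> - \<nu>) = 0" and s: "s \<in> {a..b}"
  shows "cov_op M {a..b} Z \<mu> s = cov_op M {a..b} Z \<nu> s"
proof -
  obtain C where "psd_form (signed_measures_on {a..b}) covar C" by (rule psd_form_covar)
  then interpret psd_form "signed_measures_on {a..b}" covar C .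
  note \<delta> = dirac_in_signed_measures_on[OF s]
  have "covar (\<mu> - \<nu> + \<nu>) (dirac s) = covar (\<mu> - \<nu>) (dirac s) + covar \<nu> (dirac s)"
    by (intro B_add S_closed \<mu> \<nu> \<delta>)
  also have "covar (\<mu> - \<nu>) (dirac s) = 0"
    by (rule B_null[OF S_closed(4)[OF \<mu> \<nu>] \<delta> null])
  finally show ?thesis
    by (simp add: cov_op_eq_covar_dirac[OF \<mu> s] cov_op_eq_covar_dirac[OF \<nu> s])
qed

text \<open>Completing the square: up to a term that does not depend on \<open>\<nu>\<close>, the contrast is a linear
  perturbation of size \<open>\<epsilon>\<close> of the quadratic form in \<open>\<nu> - \<mu>\<^sub>0\<close>.\<close>

lemma contrast_eq:
  assumes \<nu>: "\<nu> \<in> signed_measures_on {a..b}" and \<mu>\<^sub>0: "\<mu>\<^sub>0 \<in> signed_measures_on {a..b}"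
    and \<omega>: "\<omega> \<in> space M"
  shows "contrast M {a..b} Z (observation M {a..b} Z \<mu>\<^sub>0 \<epsilon> \<omega>) \<nu> =
    (\<epsilon> * pairing {a..b} (\<nu> - \<mu>\<^sub>0) (Z \<omega>) - covar (\<nu> - \<mu>\<^sub>0) (\<nu> - \<mu>\<^sub>0) / 2)
    + (\<epsilon> * pairing {a..b} \<mu>\<^sub>0 (Z \<omega>) + covar \<mu>\<^sub>0 \<mu>\<^sub>0 / 2)"
proof -
  obtain C where "psd_form (signed_measures_on {a..b}) covar C" by (rule psd_form_covar)
  then interpret psd_form "signed_measures_on {a..b}" covar C .
  define d where "d = \<nu> - \<mu>\<^sub>0"
  have d: "d \<in> signed_measures_on {a..b}" and \<nu>_eq: "\<nu> = \<mu>\<^sub>0 + d"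
    using \<nu> \<mu>\<^sub>0 by (auto simp: d_def S_closed)
  have "bounded_borel_on {a..b} (\<lambda>t. \<epsilon> * Z \<omega> t)"
  proof -
    obtain c where "\<And>t. t \<in> {a..b} \<Longrightarrow> \<bar>Z \<omega> t\<bar> \<le> c"
      using bounded_borel_path[OF \<omega>] unfolding bounded_borel_on_def by blast
    then have "\<bar>\<epsilon> * Z \<omega> t\<bar> \<le> \<bar>\<epsilon>\<bar> * c" if "t \<in> {a..b}" for t
      using that by (simp add: abs_mult mult_left_mono)
    moreover have "set_borel_measurable borel {a..b} (\<lambda>t. \<epsilon> * Z \<omega> t)"
      using bounded_borel_path[OF \<omega>]
      by (auto simp: bounded_borel_on_def set_borel_measurable_def mult.left_commute[of _ \<epsilon>])
    ultimately show ?thesis by (intro bounded_borel_onI)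
  qed
  then have "pairing {a..b} \<nu> (observation M {a..b} Z \<mu>\<^sub>0 \<epsilon> \<omega>)
      = pairing {a..b} \<nu> (cov_op M {a..b} Z \<mu>\<^sub>0) + \<epsilon> * pairing {a..b} \<nu> (Z \<omega>)"
    unfolding observation_def[abs_def]
    by (subst pairing_add_fun[OF bounded_borel_cov_op[OF \<mu>\<^sub>0]]) (simp_all add: pairing_scale_fun)
  then have "contrast M {a..b} Z (observation M {a..b} Z \<mu>\<^sub>0 \<epsilon> \<omega>) \<nu>
      = covar \<nu> \<mu>\<^sub>0 + \<epsilon> * pairing {a..b} \<nu> (Z \<omega>) - covar \<nu> \<nu> / 2"
    by (simp add: contrast_def pairing_cov_op \<mu>\<^sub>0 \<nu>)
  moreover have "covar \<nu> \<mu>\<^sub>0 = covar \<mu>\<^sub>0 \<mu>\<^sub>0 + covar \<mu>\<^sub>0 d"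
    unfolding \<nu>_eq by (simp add: B_add B_commute[of d \<mu>\<^sub>0] \<mu>\<^sub>0 d)
  moreover have "covar \<nu> \<nu> = covar \<mu>\<^sub>0 \<mu>\<^sub>0 + 2 * covar \<mu>\<^sub>0 d + covar d d"
    unfolding \<nu>_eq by (rule B_self_add[OF \<mu>\<^sub>0 d])
  moreover have "pairing {a..b} \<nu> (Z \<omega>) = pairing {a..b} \<mu>\<^sub>0 (Z \<omega>) + pairing {a..b} d (Z \<omega>)"
    unfolding \<nu>_eq by (rule linear_add[OF linear_pairing_path[OF \<omega>]])
  ultimately show ?thesis
    unfolding d_def[symmetric] by (simp add: distrib_left add_divide_distrib)
qed

lemma info_matrix_inner:
  assumes D: "(\<mu> has_derivative D) (at \<theta>\<^sub>0)" and DS: "\<And>u. D u \<in> signed_measures_on {a..b}"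
  shows "covar (D u) (D w) = u \<bullet> (info_matrix M {a..b} Z \<mu> \<theta>\<^sub>0 *v w)"
proof -
  obtain C where "psd_form (signed_measures_on {a..b}) covar C" by (rule psd_form_covar)
  then interpret psd_form "signed_measures_on {a..b}" covar C .
  have linD: "linear D" using D by (rule has_derivative_linear)
  have entry: "info_matrix M {a..b} Z \<mu> \<theta>\<^sub>0 $ i $ j = covar (D (axis i 1)) (D (axis j 1))" for i j
    by (simp add: info_matrix_def partial_deriv_eq[OF D] pairing_cov_op DS)
  have "linear (\<lambda>u. covar (D u) x)" "linear (\<lambda>u. covar x (D u))"
    if "x \<in> signed_measures_on {a..b}" for x
    using that by (auto intro!: linearI
        simp: linear_add[OF linD] linear_cmul[OF linD] B_add B_scale B_add_right B_scale_right DS)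
  note lin = this[OF DS]
  have "covar (D u) (D w) = (\<Sum>i\<in>UNIV. u $ i * (\<Sum>j\<in>UNIV. w $ j * covar (D (axis i 1)) (D (axis j 1))))"
  proof -
    have "covar (D u) (D w) = (\<Sum>i\<in>UNIV. u $ i * covar (D (axis i 1)) (D w))"
      using linear_eq_sum_axis[OF lin(1)[of w], of u] by simp
    moreover have "covar (D (axis i 1)) (D w) = (\<Sum>j\<in>UNIV. w $ j * covar (D (axis i 1)) (D (axis j 1)))" for i
      using linear_eq_sum_axis[OF lin(2)[of "axis i 1"], of w] by simp
    ultimately show ?thesis by simp
  qed
  also have "\<dots> = u \<bullet> (info_matrix M {a..b} Z \<mu> \<theta>\<^sub>0 *v w)"
    by (simp add: inner_vec_def matrix_vector_mult_def entry mult.commute)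
  finally show ?thesis .
qed

lemma grad_pairing_inner:
  assumes D: "(\<mu> has_derivative D) (at \<theta>\<^sub>0)" and \<omega>: "\<omega> \<in> space M"
  shows "pairing {a..b} (D u) (Z \<omega>) = u \<bullet> grad_pairing {a..b} \<mu> \<theta>\<^sub>0 (Z \<omega>)"
  using linear_eq_sum_axis[OF linear_compose[OF has_derivative_linear[OF D] linear_pairing_path[OF \<omega>]], of u]
  by (simp add: grad_pairing_def inner_vec_def partial_deriv_eq[OF D])

end

section \<open>Asymptotic normality of the maximizer\<close>

theorem theorem3p12:
  fixes M :: "'w measure" and Z :: "'w \<Rightarrow> real \<Rightarrow> real" and a b :: real and T :: "real set"
    and \<Theta> :: "(real ^ 'p) set" and \<theta>\<^sub>0 :: "real ^ 'p" and \<mu> :: "real ^ 'p \<Rightarrow> signed_measure"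
    and \<theta>hat :: "real \<Rightarrow> 'w \<Rightarrow> real ^ 'p" and \<Sigma> :: "real ^ 'p ^ 'p"
  assumes "prob_space M"
    and "a \<le> b" and T: "T = {a..b}"
    and "centered_gaussian_vector M T Z"
    and "compact \<Theta>" and "convex \<Theta>" and "\<theta>\<^sub>0 \<in> interior \<Theta>"
    and "\<forall>\<theta>\<in>\<Theta>. \<mu> \<theta> \<in> signed_measures_on T"
    and "continuous_on \<Theta> \<mu>" and "C_k_on 2 \<Theta> \<mu>"
    and "\<forall>\<theta>\<in>\<Theta>. (\<forall>t\<in>T. cov_op M T Z (\<mu> \<theta>) t = cov_op M T Z (\<mu> \<theta>\<^sub>0) t) \<longrightarrow> \<theta> = \<theta>\<^sub>0"
    and \<Sigma>: "\<Sigma> = info_matrix M T Z \<mu> \<theta>\<^sub>0" and "invertible \<Sigma>"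
    and "\<forall>\<epsilon>>0. \<forall>\<omega>\<in>space M. \<theta>hat \<epsilon> \<omega> \<in> \<Theta> \<and>
           (\<forall>\<theta>\<in>\<Theta>. contrast M T Z (observation M T Z (\<mu> \<theta>\<^sub>0) \<epsilon> \<omega>) (\<mu> \<theta>)
                 \<le> contrast M T Z (observation M T Z (\<mu> \<theta>\<^sub>0) \<epsilon> \<omega>) (\<mu> (\<theta>hat \<epsilon> \<omega>)))"
  shows "tendsto_in_prob M (\<lambda>\<epsilon> \<omega>. inverse \<epsilon> *\<^sub>R (\<theta>hat \<epsilon> \<omega> - \<theta>\<^sub>0))
           (\<lambda>\<omega>. matrix_inv \<Sigma> *v grad_pairing T \<mu> \<theta>\<^sub>0 (Z \<omega>)) (at_right 0)
       \<and> normal_vector M (\<lambda>\<omega>. matrix_inv \<Sigma> *v grad_pairing T \<mu> \<theta>\<^sub>0 (Z \<omega>)) 0 (matrix_inv \<Sigma>)"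
proof -
  interpret prob_space M by fact
  interpret gaussian_path M a b Z
    using assms(2,4) by unfold_locales (simp_all add: T)
  obtain C where "psd_form (signed_measures_on {a..b}) covar C" by (rule psd_form_covar)
  then interpret psd_form "signed_measures_on {a..b}" covar C .
  have center: "\<theta>\<^sub>0 \<in> \<Theta>" using assms(7) interior_subset by auto
  have \<mu>S: "\<mu> \<theta> \<in> signed_measures_on {a..b}" if "\<theta> \<in> \<Theta>" for \<theta>
    using assms(8) that T by auto
  obtain D where D: "(\<mu> has_derivative D) (at \<theta>\<^sub>0)"
    using assms(7,10) by (auto simp: numeral_2_eq_2 differentiable_def)
  have DS: "D u \<in> signed_measures_on {a..b}" for u
    using \<mu>S by (rule derivative_in_signed_measures_on[OF D assms(7)])
  have B_D: "covar (D u) (D w) = u \<bullet> (\<Sigma> *v w)" for u w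
    unfolding \<Sigma> T by (rule info_matrix_inner[OF D DS])
  have sym: "transpose \<Sigma> = \<Sigma>"
    by (simp add: \<Sigma> T info_matrix_def transpose_def vec_eq_iff partial_deriv_eq[OF D] pairing_cov_op DS
        B_commute)
  note inv = matrix_inv_cancel[OF \<open>invertible \<Sigma>\<close>]
  have inv_v: "\<Sigma> *v (matrix_inv \<Sigma> *v x) = x" "matrix_inv \<Sigma> *v (\<Sigma> *v x) = x" for x
    by (simp_all add: matrix_vector_mul_assoc inv)
  have sym_inv: "transpose (matrix_inv \<Sigma>) = matrix_inv \<Sigma>"
    by (rule transpose_matrix_inv_symmetric[OF \<open>invertible \<Sigma>\<close> sym])
  interpret identifiable_model "signed_measures_on {a..b}" covar C \<mu> D \<Theta> \<theta>\<^sub>0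
  proof
    show "compact \<Theta>" "\<theta>\<^sub>0 \<in> interior \<Theta>" "continuous_on \<Theta> \<mu>" "(\<mu> has_derivative D) (at \<theta>\<^sub>0)"
      by fact+
    show "\<mu> \<theta> \<in> signed_measures_on {a..b}" if "\<theta> \<in> \<Theta>" for \<theta> using that by (rule \<mu>S)
    show "D u \<in> signed_measures_on {a..b}" for u by (rule DS)
    show "\<theta> = \<theta>\<^sub>0" if "\<theta> \<in> \<Theta>" "covar (\<mu> \<theta> - \<mu> \<theta>\<^sub>0) (\<mu> \<theta> - \<mu> \<theta>\<^sub>0) = 0" for \<theta>
      using assms(11) that(1) cov_op_eq_if_covar_null[OF \<mu>S[OF that(1)] \<mu>S[OF center] that(2)] T by auto
    \<comment> \<open>A null direction of the form lies in the kernel of \<open>\<Sigma>\<close>: test with \<open>\<Sigma> *v u\<close>.\<close>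
    show "u = 0" if "covar (D u) (D u) = 0" for u
    proof -
      have "(\<Sigma> *v u) \<bullet> (\<Sigma> *v u) = 0"
        using B_null[OF DS DS that, of "\<Sigma> *v u"] B_commute[OF DS DS] by (simp add: B_D)
      then have "\<Sigma> *v u = 0" by simp
      then show ?thesis using inv_v(2)[of u] by simp
    qed
  qed
  define V where "V \<omega> = matrix_inv \<Sigma> *v grad_pairing {a..b} \<mu> \<theta>\<^sub>0 (Z \<omega>)" for \<omega>
  have "normal_vector M V 0 (matrix_inv \<Sigma>)"
    unfolding normal_vector_def
  proof (intro conjI allI)
    \<comment> \<open>Every linear functional of \<open>V\<close> is the pairing of \<open>Z\<close> with a single signed measure.\<close>
    have eq: "w \<bullet> V \<omega> = pairing {a..b} (D (matrix_inv \<Sigma> *v w)) (Z \<omega>)" if "\<omega> \<in> space M" for w \<omega>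
      by (simp add: V_def inner_symmetric_matrix[OF sym_inv] grad_pairing_inner[OF D that])
    show normal: "normal_rv M (\<lambda>\<omega>. w \<bullet> V \<omega>) (w \<bullet> 0) (w \<bullet> (matrix_inv \<Sigma> *v w))" for w
    proof -
      let ?X = "\<lambda>\<omega>. pairing {a..b} (D (matrix_inv \<Sigma> *v w)) (Z \<omega>)"
      have "(LINT \<omega>|M. (?X \<omega>)\<^sup>2) = covar (D (matrix_inv \<Sigma> *v w)) (D (matrix_inv \<Sigma> *v w))"
        by (simp add: covar_def power2_eq_square)
      also have "\<dots> = w \<bullet> (matrix_inv \<Sigma> *v w)"
        by (simp add: B_D inv_v inner_commute)
      finally have var: "(LINT \<omega>|M. (?X \<omega>)\<^sup>2) = w \<bullet> (matrix_inv \<Sigma> *v w)" .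
      have "normal_rv M ?X 0 (w \<bullet> (matrix_inv \<Sigma> *v w))"
        unfolding var[symmetric] by (rule normal_pairing[OF DS])
      moreover have "distr M borel ?X = distr M borel (\<lambda>\<omega>. w \<bullet> V \<omega>)"
        by (rule distr_cong[OF refl refl]) (simp only: eq)
      moreover have "?X \<in> borel_measurable M \<longleftrightarrow> (\<lambda>\<omega>. w \<bullet> V \<omega>) \<in> borel_measurable M"
        by (rule measurable_cong) (simp only: eq)
      ultimately show ?thesis by (simp only: normal_rv_def inner_zero_right simp_thms)
    qed
    show "V \<in> borel_measurable M"
    proof (rule borel_measurable_euclidean_space[THEN iffD2], rule ballI)
      fix i :: "real ^ 'p"
      have "(\<lambda>\<omega>. i \<bullet> V \<omega>) \<in> borel_measurable M"
        using normal[of i] by (simp add: normal_rv_def)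
      then show "(\<lambda>\<omega>. V \<omega> \<bullet> i) \<in> borel_measurable M"
        by (subst inner_commute)
    qed
    show "transpose (matrix_inv \<Sigma>) = matrix_inv \<Sigma>" by (rule sym_inv)
  qed
  moreover have "tendsto_in_prob M (\<lambda>\<epsilon> \<omega>. inverse \<epsilon> *\<^sub>R (\<theta>hat \<epsilon> \<omega> - \<theta>\<^sub>0)) V (at_right 0)"
    unfolding tendsto_in_prob_def
  proof (intro allI impI)
    fix \<delta> :: real assume \<delta>: "0 < \<delta>"
    show "((\<lambda>\<epsilon>. outer_measure_of M {\<omega>\<in>space M. dist (inverse \<epsilon> *\<^sub>R (\<theta>hat \<epsilon> \<omega> - \<theta>\<^sub>0)) (V \<omega>) > \<delta>}) \<longlongrightarrow> 0)
        (at_right 0)"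
    proof (rule order_tendstoI)
      fix e :: ennreal assume e: "0 < e"
      have "(\<lambda>n. ennreal (1 - prob (paths_bounded_by (real n)))) \<longlonglongrightarrow> ennreal (1 - 1)"
        by (intro tendsto_ennrealI tendsto_diff tendsto_const prob_paths_bounded_by_LIMSEQ)
      then have "\<forall>\<^sub>F n in sequentially. ennreal (1 - prob (paths_bounded_by (real n))) < e"
        by (rule order_tendstoD(2)) (use e in simp)
      then obtain n where n: "ennreal (1 - prob (paths_bounded_by (real n))) < e"
        by (auto simp: eventually_sequentially)
      show "\<forall>\<^sub>F \<epsilon> in at_right 0.
          outer_measure_of M {\<omega>\<in>space M. dist (inverse \<epsilon> *\<^sub>R (\<theta>hat \<epsilon> \<omega> - \<theta>\<^sub>0)) (V \<omega>) > \<delta>} < e"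
      proof (rule argmax_asymptotics[of "2 * real n" \<delta>])
        show "0 \<le> 2 * real n" by simp
        show "0 < \<delta>" by (rule \<delta>)
        fix \<epsilon>\<^sub>0 assume \<epsilon>\<^sub>0: "0 < \<epsilon>\<^sub>0" and close: "\<And>\<epsilon> l \<theta> v. \<lbrakk>0 < \<epsilon>; \<epsilon> < \<epsilon>\<^sub>0; linear l;
           \<And>x. x \<in> signed_measures_on {a..b} \<Longrightarrow> \<bar>l x\<bar> \<le> 2 * real n * norm x;
           \<And>u. l (D u) = covar (D v) (D u); \<theta> \<in> \<Theta>;
           \<And>\<theta>'. \<theta>' \<in> \<Theta> \<Longrightarrow> \<epsilon> * l (\<mu> \<theta>' - \<mu> \<theta>\<^sub>0) - covar (\<mu> \<theta>' - \<mu> \<theta>\<^sub>0) (\<mu> \<theta>' - \<mu> \<theta>\<^sub>0) / 2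
             \<le> \<epsilon> * l (\<mu> \<theta> - \<mu> \<theta>\<^sub>0) - covar (\<mu> \<theta> - \<mu> \<theta>\<^sub>0) (\<mu> \<theta> - \<mu> \<theta>\<^sub>0) / 2\<rbrakk>
          \<Longrightarrow> norm (inverse \<epsilon> *\<^sub>R (\<theta> - \<theta>\<^sub>0) - v) \<le> \<delta>"
        \<comment> \<open>For small \<open>\<epsilon>\<close> the deviation exceeds \<open>\<delta>\<close> only where the path is not bounded by \<open>n\<close>; that
          event is measurable, so the outer measure causes no difficulty.\<close>
        have "\<forall>\<^sub>F \<epsilon> in at_right 0. 0 < \<epsilon> \<and> \<epsilon> < \<epsilon>\<^sub>0"
          using \<epsilon>\<^sub>0 by (auto simp: eventually_at_right_field)
        then show "\<forall>\<^sub>F \<epsilon> in at_right 0.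
            outer_measure_of M {\<omega>\<in>space M. dist (inverse \<epsilon> *\<^sub>R (\<theta>hat \<epsilon> \<omega> - \<theta>\<^sub>0)) (V \<omega>) > \<delta>} < e"
        proof eventually_elim
          case (elim \<epsilon>)
          have "dist (inverse \<epsilon> *\<^sub>R (\<theta>hat \<epsilon> \<omega> - \<theta>\<^sub>0)) (V \<omega>) \<le> \<delta>" if \<omega>: "\<omega> \<in> paths_bounded_by (real n)" for \<omega>
          proof -
            have sp: "\<omega> \<in> space M" using \<omega> by (simp add: paths_bounded_by_def)
            have hat: "\<theta>hat \<epsilon> \<omega> \<in> \<Theta>"
              and max: "\<And>\<theta>. \<theta> \<in> \<Theta> \<Longrightarrow> contrast M {a..b} Z (observation M {a..b} Z (\<mu> \<theta>\<^sub>0) \<epsilon> \<omega>) (\<mu> \<theta>)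
                  \<le> contrast M {a..b} Z (observation M {a..b} Z (\<mu> \<theta>\<^sub>0) \<epsilon> \<omega>) (\<mu> (\<theta>hat \<epsilon> \<omega>))"
              using assms(14) elim sp T by auto
            show ?thesis
              unfolding dist_norm
            proof (rule close[of \<epsilon> "\<lambda>\<nu>. pairing {a..b} \<nu> (Z \<omega>)" "V \<omega>"])
              show "linear (\<lambda>\<nu>. pairing {a..b} \<nu> (Z \<omega>))" by (rule linear_pairing_path[OF sp])
              show "\<bar>pairing {a..b} x (Z \<omega>)\<bar> \<le> 2 * real n * norm x" for x
                by (rule abs_pairing_path_le[OF \<omega>])
              show "pairing {a..b} (D u) (Z \<omega>) = covar (D (V \<omega>)) (D u)" for u
                by (simp add: B_commute[OF DS DS] B_D V_def inv_v grad_pairing_inner[OF D sp])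
              show "\<epsilon> * pairing {a..b} (\<mu> \<theta>' - \<mu> \<theta>\<^sub>0) (Z \<omega>) - covar (\<mu> \<theta>' - \<mu> \<theta>\<^sub>0) (\<mu> \<theta>' - \<mu> \<theta>\<^sub>0) / 2
                  \<le> \<epsilon> * pairing {a..b} (\<mu> (\<theta>hat \<epsilon> \<omega>) - \<mu> \<theta>\<^sub>0) (Z \<omega>)
                    - covar (\<mu> (\<theta>hat \<epsilon> \<omega>) - \<mu> \<theta>\<^sub>0) (\<mu> (\<theta>hat \<epsilon> \<omega>) - \<mu> \<theta>\<^sub>0) / 2" if "\<theta>' \<in> \<Theta>" for \<theta>'
                using max[OF that] contrast_eq[OF \<mu>S[OF that] \<mu>S[OF center] sp, of \<epsilon>]
                  contrast_eq[OF \<mu>S[OF hat] \<mu>S[OF center] sp, of \<epsilon>] by linarith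
            qed (use elim hat in auto)
          qed
          then have "{\<omega>\<in>space M. dist (inverse \<epsilon> *\<^sub>R (\<theta>hat \<epsilon> \<omega> - \<theta>\<^sub>0)) (V \<omega>) > \<delta>}
              \<subseteq> space M - paths_bounded_by (real n)"
            by force
          then have "outer_measure_of M {\<omega>\<in>space M. dist (inverse \<epsilon> *\<^sub>R (\<theta>hat \<epsilon> \<omega> - \<theta>\<^sub>0)) (V \<omega>) > \<delta>}
              \<le> outer_measure_of M (space M - paths_bounded_by (real n))"
            by (rule outer_measure_of_mono)
          also have "\<dots> = ennreal (1 - prob (paths_bounded_by (real n)))"
            using paths_bounded_by_sets by (simp add: emeasure_eq_measure prob_compl)
          also note n
          finally show ?case .
        qed
      qed
    qed simp
  qed
  ultimately show ?thesis by (simp add: V_def[abs_def] T)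
qed

end
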